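(* Let $X_1,X_2,\dots$ be real independent random variables with $E(X_j)=0$, $E(X_j^2)=1$ and $E(|X_j|^3)\le M<\infty$ for all $j$, where $M$ does not depend on $j$. For $n\ge3$ let $r_n=\lfloor\frac{n-1}2\rfloor$, $$I_n(\lambda)=\frac1n\Big|\sum_{j=1}^n e^{-ij\lambda}X_j\Big|^2,\qquad F_n(x)=\frac1{r_n}\sum_{k=1}^{r_n}1_{\{I_n(2\pi k/n)\le x\}} .$$ Then with probability $1$, $$\sup_{x\ge0}\big|F_n(x)-(1-e^{-x})\big|\to0\quad\text{as } n\to\infty .$$
   Context: $I_n$ is the periodogram of the sequence $(X_j)$ and $F_n$ is the (random) empirical distribution function of the periodogram. Here $i=\sqrt{-1}$ in the exponent. *)

theory Defs
  imports "HOL-Probability.Probability"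
begin

text \<open>
  A data sequence \<open>x\<close> is indexed from 1: only \<open>x 1, \<dots>, x n\<close> enter the periodogram of order \<open>n\<close>,
  and \<open>x 0\<close> is never used.
\<close>

definition periodogram :: "(nat \<Rightarrow> real) \<Rightarrow> nat \<Rightarrow> real \<Rightarrow> real" where
  "periodogram x n \<theta> =
     1 / real n * (cmod (\<Sum>j=1..n. exp (- (\<i> * of_nat j * of_real \<theta>)) * of_real (x j)))\<^sup>2"

text \<open>
  For \<open>n \<ge> 1\<close> the truncated natural-number expression below is the floor of \<open>(n - 1) / 2\<close>.
  It is positive, so that the empirical distribution function is meaningful, exactly when \<open>n \<ge> 3\<close>.
\<close>

definition num_freqs :: "nat \<Rightarrow> nat" where
  "num_freqs n = (n - 1) div 2"

definition periodogram_edf :: "(nat \<Rightarrow> real) \<Rightarrow> nat \<Rightarrow> real \<Rightarrow> real" where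
  "periodogram_edf x n t =
     1 / real (num_freqs n) *
     (\<Sum>k=1..num_freqs n. of_bool (periodogram x n (2 * pi * real k / real n) \<le> t))"

end

theory Submission
  imports Defs "HOL-Real_Asymp.Real_Asymp"
begin

text \<open>
  If \<open>I\<close> is exponentially distributed then \<open>exp (- I)\<close> is uniform on \<open>[0, 1]\<close>.  So put
  \<open>U k = exp (- I n (2 \<pi> k / n))\<close>: it is enough that, almost surely, the \<open>m\<close>-th empirical moment of
  the \<open>U k\<close> tends to \<open>1 / (m + 1)\<close> for every natural number \<open>m\<close>.  The Weierstrass theorem then
  turns moments into averages of continuous functions, and monotonicity turns these into uniform
  convergence of the empirical distribution functions
  (\<open>average_continuous_tendsto\<close>, \<open>upper_fraction_uniform_limit\<close>).

  The \<open>m\<close>-th moment is an average of the values \<open>exp (- m |z|\<^sup>2)\<close> at the normalised Fourier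
  coefficients \<open>z\<close> of the data (\<open>periodogram_laplace\<close>).  It is a smooth function of the data,
  and its convergence rests on three ingredients.

  \<^item> \<^bold>\<open>The mean.\<close>  The function \<open>exp (- m |z|\<^sup>2)\<close> is a Gaussian mixture of the characters
    \<open>z \<mapsto> exp (i \<langle>w, z\<rangle>)\<close>.  For a fixed \<open>w\<close> the expected character is a product of
    characteristic functions of the single observations, and the bound on the third moments makes
    it close to its Gaussian counterpart, uniformly in the frequency.  Orthogonality of the characters of
    \<open>\<int>/n\<int>\<close> identifies the limit, and dominated convergence in \<open>w\<close> gives the mean
    \<open>1 / (m + 1)\<close> (\<open>expectation_periodogram_laplace_tendsto\<close>).

  \<^item> \<^bold>\<open>Concentration for bounded data.\<close>  Replacing one observation moves the average by a
    linear term plus \<open>O(1/n)\<close>.  By Parseval the squares of the linear terms, summed over all \<open>n\<close>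
    observations, are only \<open>O(1/n)\<close>; a variance bound alone would not be summable, but applying the
    Efron--Stein inequality a second time, to the square of the centred average, bounds the fourth
    central moment by \<open>O(1/n\<^sup>2)\<close> (\<open>fourth_central_moment_le\<close>), and almost sure convergence
    follows.

  \<^item> \<^bold>\<open>Clipping.\<close>  Only third moments are available, so the observations are cut off at the
    level \<open>n powr (1/16)\<close>.  The constants above then grow by a small power of \<open>n\<close> that the fourth
    moment tolerates.  By Bessel's inequality the average moves by at most a multiple of the
    root mean square of the clipping errors, and along dyadic blocks the mean square has a
    geometrically decaying expectation (\<open>clip_error_AE_tendsto_0\<close>).
\<close>

section \<open>Uniform distribution from moments\<close>

lemma integral_unit_power: "((\<lambda>t::real. t ^ m) has_integral 1 / (real m + 1)) {0..1}"
proof -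
  have "((\<lambda>t. t ^ Suc m / real (Suc m)) has_real_derivative t ^ m) (at t within {0..1})" for t :: real
    by (auto intro!: derivative_eq_intros simp del: power_Suc of_nat_Suc)
  then have "((\<lambda>t::real. t ^ m) has_integral (1 ^ Suc m / real (Suc m) - 0 ^ Suc m / real (Suc m))) {0..1}"
    by (intro fundamental_theorem_of_calculus)
      (auto simp: has_real_derivative_iff_has_vector_derivative[symmetric] simp del: power_Suc of_nat_Suc)
  then show ?thesis by (simp add: add.commute)
qed

text \<open>
  For \<open>r = 0\<close> the average is 0 by the convention \<open>1 / 0 = 0\<close>; hence the condition on the sign
  of \<open>e\<close>.
\<close>

lemma norm_average_le:
  fixes g :: "nat \<Rightarrow> 'a :: real_normed_field"
  assumes "\<And>k. k \<in> {1..r} \<Longrightarrow> norm (g k) \<le> e" "e \<ge> 0"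
  shows "norm (1 / of_nat r * (\<Sum>k=1..r. g k)) \<le> e"
proof (cases "r = 0")
  case False
  have "norm (\<Sum>k=1..r. g k) \<le> (\<Sum>k=1..r. e)"
    using assms by (intro sum_norm_le) auto
  then show ?thesis
    using False by (simp add: norm_mult norm_divide field_simps)
qed (use assms in simp)

text \<open>
  Both sides are linear in \<open>c\<close> and continuous for the uniform norm, so Weierstrass reduces
  the claim to monomials.
\<close>

lemma average_continuous_tendsto:
  fixes U :: "nat \<Rightarrow> nat \<Rightarrow> real" and r :: "nat \<Rightarrow> nat"
  assumes U: "\<And>n k. k \<in> {1..r n} \<Longrightarrow> U n k \<in> {0..1}"
    and moments: "\<And>m. (\<lambda>n. 1 / real (r n) * (\<Sum>k=1..r n. U n k ^ m)) \<longlonglongrightarrow> 1 / (real m + 1)"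
    and c: "continuous_on {0..1} c"
  shows "(\<lambda>n. 1 / real (r n) * (\<Sum>k=1..r n. c (U n k))) \<longlonglongrightarrow> integral {0..1} c"
proof (rule tendstoI)
  fix e :: real assume e: "e > 0"
  obtain p where p: "real_polynomial_function p" "\<And>t. t \<in> {0..1} \<Longrightarrow> \<bar>c t - p t\<bar> < e / 3"
    using Stone_Weierstrass_real_polynomial_function[OF compact_Icc c, of "e / 3"] e by auto
  then obtain a d where pa: "p = (\<lambda>t. \<Sum>i\<le>d. a i * t ^ i)"
    by (auto simp: real_polynomial_function_iff_sum)
  have p_int: "(p has_integral (\<Sum>i\<le>d. a i * (1 / (real i + 1)))) {0..1}"
    unfolding pa by (intro has_integral_sum has_integral_mult_right integral_unit_power) auto
  have c_int: "c integrable_on {0..1}"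
    using c by (rule integrable_continuous_real)
  \<comment> \<open>A linear combination of moments.\<close>
  have "(\<lambda>n. \<Sum>i\<le>d. a i * (1 / real (r n) * (\<Sum>k=1..r n. U n k ^ i))) \<longlonglongrightarrow> integral {0..1} p"
    unfolding integral_unique[OF p_int] by (intro tendsto_sum tendsto_mult tendsto_const moments)
  moreover have "(\<Sum>i\<le>d. a i * (1 / real (r n) * (\<Sum>k=1..r n. U n k ^ i))) =
      1 / real (r n) * (\<Sum>k=1..r n. p (U n k))" for n
    unfolding pa by (subst sum.swap) (simp add: sum_distrib_left sum_divide_distrib)
  ultimately have "(\<lambda>n. 1 / real (r n) * (\<Sum>k=1..r n. p (U n k))) \<longlonglongrightarrow> integral {0..1} p"
    by simp
  then have "\<forall>\<^sub>F n in sequentially. dist (1 / real (r n) * (\<Sum>k=1..r n. p (U n k))) (integral {0..1} p) < e / 3"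
    using e by (intro tendstoD) auto
  then show "\<forall>\<^sub>F n in sequentially. dist (1 / real (r n) * (\<Sum>k=1..r n. c (U n k))) (integral {0..1} c) < e"
  proof eventually_elim
    case (elim n)
    have "\<bar>1 / real (r n) * (\<Sum>k=1..r n. c (U n k) - p (U n k))\<bar> \<le> e / 3"
      using p(2)[OF U] e by (intro norm_average_le[where 'a = real, unfolded real_norm_def]) (auto intro: less_imp_le)
    then have "\<bar>1 / real (r n) * (\<Sum>k=1..r n. c (U n k)) - 1 / real (r n) * (\<Sum>k=1..r n. p (U n k))\<bar> \<le> e / 3"
      by (simp add: sum_subtractf right_diff_distrib diff_divide_distrib)
    moreover have "\<bar>integral {0..1} c - integral {0..1} p\<bar> \<le> e / 3"
    proof -
      have "norm (integral {0..1} (\<lambda>t. c t - p t)) \<le> integral {0..1} (\<lambda>t::real. e / 3)"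
        using p c_int p_int
        by (intro integral_norm_bound_integral integrable_diff) (auto intro: less_imp_le)
      then show ?thesis
        using c_int p_int e by (subst (asm) integral_diff) auto
    qed
    ultimately show ?case
      using elim unfolding dist_real_def by linarith
  qed
qed

text \<open>
  Upper tails are used because the map
  \<open>t \<mapsto> exp (- t)\<close> reverses the order: it turns \<open>I \<le> t\<close> into \<open>exp (- t) \<le> exp (- I)\<close>.
\<close>

definition upper_fraction :: "(nat \<Rightarrow> real) \<Rightarrow> nat \<Rightarrow> real \<Rightarrow> real" where
  "upper_fraction U r u = 1 / real r * (\<Sum>k=1..r. of_bool (u \<le> U k))"

lemma upper_fraction_bounds: "0 \<le> upper_fraction U r u" "upper_fraction U r u \<le> 1"
proof -
  show "0 \<le> upper_fraction U r u"
    by (simp add: upper_fraction_def sum_nonneg)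
  have "\<bar>upper_fraction U r u\<bar> \<le> 1"
    unfolding upper_fraction_def by (rule norm_average_le[where 'a = real, unfolded real_norm_def]) auto
  then show "upper_fraction U r u \<le> 1" by simp
qed

lemma average_mono:
  fixes f g :: "nat \<Rightarrow> real"
  assumes "\<And>k. k \<in> {1..r} \<Longrightarrow> f k \<le> g k"
  shows "1 / real r * (\<Sum>k=1..r. f k) \<le> 1 / real r * (\<Sum>k=1..r. g k)"
  using assms by (intro mult_left_mono sum_mono) auto

lemma upper_fraction_antimono: "u \<le> v \<Longrightarrow> upper_fraction U r v \<le> upper_fraction U r u"
  unfolding upper_fraction_def by (intro average_mono) auto

text \<open>
  The piecewise linear function that rises from 0 at \<open>v\<close> to 1 at \<open>w\<close> lies between the
  indicators of the two half-lines.
\<close>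

lemma upper_fraction_sandwich:
  fixes U :: "nat \<Rightarrow> nat \<Rightarrow> real" and r :: "nat \<Rightarrow> nat"
  assumes U: "\<And>n k. k \<in> {1..r n} \<Longrightarrow> U n k \<in> {0..1}"
    and moments: "\<And>m. (\<lambda>n. 1 / real (r n) * (\<Sum>k=1..r n. U n k ^ m)) \<longlonglongrightarrow> 1 / (real m + 1)"
    and vw: "0 \<le> v" "v < w" "w \<le> 1" and e: "e > 0"
  shows "\<forall>\<^sub>F n in sequentially.
           upper_fraction (U n) (r n) w < 1 - v + e \<and> 1 - w - e < upper_fraction (U n) (r n) v"
proof -
  define c where "c t = max 0 (min 1 ((t - v) / (w - v)))" for t :: real
  have c_cont: "continuous_on S c" for S
    unfolding c_def using vw by (intro continuous_intros) auto
  have c01: "0 \<le> c t" "c t \<le> 1" for t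
    by (auto simp: c_def)
  have c0: "c t = 0" if "t \<le> v" for t
    using that vw by (simp add: c_def divide_nonpos_pos)
  have c1: "c t = 1" if "w \<le> t" for t
    using that vw by (simp add: c_def)
  have c_int: "c integrable_on {a..b}" for a b
    using c_cont by (rule integrable_continuous_real)
  have "integral {0..1} c = integral {0..v} c + integral {v..1} c"
    using vw c_int by (intro Henstock_Kurzweil_Integration.integral_combine[symmetric]) auto
  also have "integral {0..v} c = integral {0..v} (\<lambda>_. 0)"
    by (intro integral_cong) (auto simp: c0)
  also have "integral {v..1} c \<le> integral {v..1} (\<lambda>_. 1)"
    by (intro integral_le c_int) (auto simp: c01)
  finally have up: "integral {0..1} c \<le> 1 - v"
    using vw by simp
  have "integral {0..1} c = integral {0..w} c + integral {w..1} c"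
    using vw c_int by (intro Henstock_Kurzweil_Integration.integral_combine[symmetric]) auto
  also have "integral {w..1} c = integral {w..1} (\<lambda>_. 1)"
    by (intro integral_cong) (auto simp: c1)
  finally have "integral {0..1} c = integral {0..w} c + (1 - w)"
    using vw by simp
  moreover have "integral {0..w} c \<ge> 0"
    by (intro integral_nonneg c_int) (auto simp: c01)
  ultimately have low: "1 - w \<le> integral {0..1} c"
    by simp
  have "\<forall>\<^sub>F n in sequentially. dist (1 / real (r n) * (\<Sum>k=1..r n. c (U n k))) (integral {0..1} c) < e"
    by (rule tendstoD[OF average_continuous_tendsto[OF U moments c_cont] e])
  then show ?thesis
  proof eventually_elim
    case (elim n)
    have "upper_fraction (U n) (r n) w \<le> 1 / real (r n) * (\<Sum>k=1..r n. c (U n k))"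
      unfolding upper_fraction_def by (intro average_mono) (auto simp: c1 c01)
    moreover have "1 / real (r n) * (\<Sum>k=1..r n. c (U n k)) \<le> upper_fraction (U n) (r n) v"
      unfolding upper_fraction_def by (intro average_mono) (auto simp: c0 c01)
    ultimately show ?case
      using elim up low by (auto simp: dist_real_def)
  qed
qed

text \<open>
  Control on a finite grid suffices: between grid points monotonicity squeezes the fraction
  between its values at neighbouring grid points, and the limit changes by at most a grid step.
\<close>

lemma upper_fraction_uniform_limit:
  fixes U :: "nat \<Rightarrow> nat \<Rightarrow> real" and r :: "nat \<Rightarrow> nat"
  assumes U: "\<And>n k. k \<in> {1..r n} \<Longrightarrow> U n k \<in> {0..1}"
    and moments: "\<And>m. (\<lambda>n. 1 / real (r n) * (\<Sum>k=1..r n. U n k ^ m)) \<longlonglongrightarrow> 1 / (real m + 1)"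
  shows "uniform_limit {0..1} (\<lambda>n. upper_fraction (U n) (r n)) (\<lambda>u. 1 - u) sequentially"
proof (rule uniform_limitI)
  fix e :: real assume e: "e > 0"
  obtain N :: nat where N: "N > 0" "4 / e < real N"
    using reals_Archimedean2[of "4 / e"] e
    by (metis divide_pos_pos gr0I less_asym of_nat_0 zero_less_numeral)
  have N2: "2 / real N < e / 2"
    using N e by (simp add: field_simps)
  define g where "g i = real i / real N" for i
  have "\<forall>\<^sub>F n in sequentially. \<forall>i\<in>{..<N}.
      upper_fraction (U n) (r n) (g (Suc i)) < 1 - g i + e / 2 \<and>
      1 - g (Suc i) - e / 2 < upper_fraction (U n) (r n) (g i)"
    using N e
    by (intro eventually_ball_finite ballI upper_fraction_sandwich[OF U moments])
      (auto simp: g_def field_simps)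
  then show "\<forall>\<^sub>F n in sequentially. \<forall>u\<in>{0..1}. dist (upper_fraction (U n) (r n) u) (1 - u) < e"
  proof eventually_elim
    case (elim n)
    let ?G = "upper_fraction (U n) (r n)"
    show ?case
    proof
      fix u :: real assume u: "u \<in> {0..1}"
      obtain i where i: "i < N" "g i \<le> u" "u \<le> g (Suc i)"
      proof (cases "u = 1")
        case True
        then show ?thesis
          using N by (intro that[of "N - 1"]) (auto simp: g_def field_simps)
      next
        case False
        define i where "i = nat \<lfloor>u * real N\<rfloor>"
        have un: "0 \<le> u * real N" using u by simp
        have "real i \<le> u * real N" "u * real N < real i + 1"
          unfolding i_def using un by (auto simp: of_nat_floor)
        moreover have "u * real N < real N"
          using u False N by simp
        ultimately have "real i < real N" "real i \<le> u * real N" "u * real N < real i + 1"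
          by linarith+
        then show ?thesis
          using N by (intro that[of i]) (auto simp: g_def field_simps)
      qed
      have step: "g (Suc j) = g j + 1 / real N" for j
        by (simp add: g_def add_divide_distrib)
      have up: "?G u < 1 - u + e"
      proof (cases i)
        case 0
        \<comment> \<open>In the first cell no grid point lies before, but there the limit is within one grid step of 1.\<close>
        have "u \<le> 1 / real N" using i 0 by (simp add: g_def)
        then show ?thesis
          using upper_fraction_bounds(2)[of "U n" "r n" u] N2 N e by linarith
      next
        case (Suc j)
        have "?G u \<le> ?G (g i)" by (rule upper_fraction_antimono[OF i(2)])
        also have "\<dots> < 1 - g j + e / 2" using elim i Suc by auto
        also have "\<dots> < 1 - u + e" using i(3) step[of i] step[of j] Suc N2 by simp
        finally show ?thesis .
      qed
      have low: "1 - u - e < ?G u"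
      proof (cases "Suc i < N")
        case False
        \<comment> \<open>In the last cell no grid point lies beyond, but there the limit is at most one grid step.\<close>
        then have "g (Suc i) = 1" using i N by (simp add: g_def)
        then have "1 - u \<le> 1 / real N" using i step[of i] by simp
        then show ?thesis
          using upper_fraction_bounds(1)[of "U n" "r n" u] N2 N e by linarith
      next
        case True
        have "1 - u - e < 1 - g (Suc (Suc i)) - e / 2"
          using i(2) step[of i] step[of "Suc i"] N2 by simp
        also have "\<dots> < ?G (g (Suc i))" using elim True by auto
        also have "\<dots> \<le> ?G u" by (rule upper_fraction_antimono[OF i(3)])
        finally show ?thesis .
      qed
      show "dist (?G u) (1 - u) < e"
        using up low by (auto simp: dist_real_def)
    qed
  qed
qed

section \<open>Characters at the Fourier frequencies\<close>

text \<open>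
  A geometric sum over a nontrivial root of unity.
\<close>

lemma sum_cis_eq_0:
  fixes d :: int
  assumes "n > 0" "\<not> int n dvd d"
  shows "(\<Sum>j=1..n. cis (2 * pi * real_of_int d * real j / real n)) = 0"
proof -
  define z where "z = cis (2 * pi * real_of_int d / real n)"
  have pow: "cis (2 * pi * real_of_int d * real j / real n) = z ^ j" for j
    unfolding z_def Complex.DeMoivre by (simp add: mult_ac)
  have zn: "z ^ n = 1"
    using assms(1) cis_multiple_2pi[of "real_of_int d"] by (simp add: z_def Complex.DeMoivre)
  have "z \<noteq> 1"
  proof
    assume "z = 1"
    then have "cos (2 * pi * real_of_int d / real n) = 1"
      by (metis z_def cis.simps(1) one_complex.simps(1))
    then obtain q :: int where "2 * pi * real_of_int d / real n = real_of_int q * (2 * pi)"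
      by (auto simp: cos_one_2pi_int)
    then have "real_of_int d = real_of_int (q * int n)"
      using assms(1) by (simp add: field_simps)
    then have "d = q * int n"
      by (simp only: of_int_eq_iff)
    with assms(2) show False by simp
  qed
  moreover have "(\<Sum>j=1..n. z ^ j) = z * (\<Sum>j<n. z ^ j)"
    by (simp add: sum_distrib_left sum.atLeast1_atMost_eq)
  moreover have "(1 - z) * (\<Sum>j<n. z ^ j) = 0"
    using sum_gp_basic[of z "n - 1"] assms(1) zn
    by (metis diff_self one_diff_power_eq)
  ultimately have "(\<Sum>j=1..n. z ^ j) = 0"
    by simp
  then show ?thesis
    by (simp add: pow)
qed

definition fourier_char :: "nat \<Rightarrow> nat \<Rightarrow> nat \<Rightarrow> complex" where
  "fourier_char n k j = exp (- (\<i> * of_nat j * of_real (2 * pi * real k / real n)))"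

lemma fourier_char_eq_cis: "fourier_char n k j = cis (- (2 * pi * real k * real j / real n))"
  by (simp add: fourier_char_def cis_conv_exp field_simps)

lemma norm_fourier_char [simp]: "cmod (fourier_char n k j) = 1"
  by (simp add: fourier_char_eq_cis)

lemma freq_bounds:
  assumes "k \<in> {1..num_freqs n}"
  shows "0 < k" "2 * k < n" "n > 0"
  using assms by (auto simp: num_freqs_def)

lemma fourier_char_orthogonal:
  assumes "k \<in> {1..num_freqs n}" "l \<in> {1..num_freqs n}"
  shows "(\<Sum>j=1..n. fourier_char n k j * cnj (fourier_char n l j)) = (if k = l then of_nat n else 0)"
proof (cases "k = l")
  case True
  then show ?thesis
    by (simp add: complex_norm_square[symmetric])
next
  case False
  note b = freq_bounds[OF assms(1)] freq_bounds[OF assms(2)]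
  have "fourier_char n k j * cnj (fourier_char n l j) = cis (2 * pi * real_of_int (int l - int k) * real j / real n)" for j
    using b by (simp add: fourier_char_eq_cis cis_cnj cis_mult field_simps)
  moreover have "\<not> int n dvd (int l - int k)"
    using b False dvd_imp_le_int[of "int l - int k" "int n"] by auto
  ultimately show ?thesis
    using sum_cis_eq_0[of n "int l - int k"] b False by simp
qed

text \<open>
  The square of the character with index \<open>k\<close> has index \<open>2 k\<close>, which is nontrivial because
  \<open>0 < 2 k < n\<close>.  This is what makes the Gaussian limit of a Fourier coefficient circular.
\<close>

lemma sum_fourier_char_square_eq_0:
  assumes "k \<in> {1..num_freqs n}"
  shows "(\<Sum>j=1..n. (fourier_char n k j)\<^sup>2) = 0"
proof -
  note b = freq_bounds[OF assms(1)]
  have "(fourier_char n k j)\<^sup>2 = cis (2 * pi * real_of_int (- 2 * int k) * real j / real n)" for j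
    by (simp add: fourier_char_eq_cis power2_eq_square cis_mult field_simps)
  moreover have "\<not> int n dvd (- 2 * int k)"
    using b by (auto dest!: zdvd_imp_le)
  ultimately show ?thesis
    using sum_cis_eq_0[of n "- 2 * int k"] b by simp
qed

text \<open>
  Distinct characters are orthogonal, so the double sum reduces to its diagonal.  This form
  sums over the time index; it measures how strongly each observation influences a function of the
  Fourier coefficients.
\<close>

lemma fourier_char_parseval:
  "(\<Sum>j=1..n. (cmod (\<Sum>k=1..num_freqs n. c k * fourier_char n k j))\<^sup>2) =
     real n * (\<Sum>k=1..num_freqs n. (cmod (c k))\<^sup>2)"
proof -
  let ?K = "{1..num_freqs n}"
  have "complex_of_real (\<Sum>j=1..n. (cmod (\<Sum>k\<in>?K. c k * fourier_char n k j))\<^sup>2) =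
      (\<Sum>j=1..n. \<Sum>k\<in>?K. \<Sum>l\<in>?K. c k * cnj (c l) * (fourier_char n k j * cnj (fourier_char n l j)))"
    unfolding of_real_sum complex_norm_square cnj_sum sum_product by (simp add: mult_ac)
  also have "\<dots> = (\<Sum>k\<in>?K. \<Sum>l\<in>?K. c k * cnj (c l) * (\<Sum>j=1..n. fourier_char n k j * cnj (fourier_char n l j)))"
    unfolding sum_distrib_left
    by (subst sum.swap, rule sum.cong[OF refl], subst sum.swap, rule refl)
  also have "\<dots> = (\<Sum>k\<in>?K. \<Sum>l\<in>?K. if k = l then c k * cnj (c l) * of_nat n else 0)"
    by (intro sum.cong refl) (subst fourier_char_orthogonal, auto)
  also have "\<dots> = complex_of_real (real n * (\<Sum>k\<in>?K. (cmod (c k))\<^sup>2))"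
    unfolding of_real_mult of_real_sum complex_norm_square by (simp add: sum_distrib_left mult_ac)
  finally show ?thesis
    by (simp only: of_real_eq_iff)
qed

definition dft :: "(nat \<Rightarrow> real) \<Rightarrow> nat \<Rightarrow> nat \<Rightarrow> complex" where
  "dft x n k = (\<Sum>j=1..n. fourier_char n k j * of_real (x j))"

lemma periodogram_eq_dft:
  "periodogram x n (2 * pi * real k / real n) = (cmod (dft x n k))\<^sup>2 / real n"
  by (simp add: periodogram_def dft_def fourier_char_def)

lemma dft_diff: "dft x n k - dft y n k = dft (\<lambda>j. x j - y j) n k"
  by (simp add: dft_def sum_subtractf algebra_simps)

text \<open>
  Duality: pairing the Fourier coefficients with themselves and exchanging the sums gives,
  by Cauchy--Schwarz and the Parseval identity for the time index, \<open>S\<^sup>2 \<le> n S \<Sum>(x j)\<^sup>2\<close> for the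
  left-hand side \<open>S\<close>.
\<close>

lemma dft_bessel:
  "(\<Sum>k=1..num_freqs n. (cmod (dft x n k))\<^sup>2) \<le> real n * (\<Sum>j=1..n. (x j)\<^sup>2)"
proof -
  let ?K = "{1..num_freqs n}"
  define S where "S = (\<Sum>k\<in>?K. (cmod (dft x n k))\<^sup>2)"
  define v where "v j = (\<Sum>k\<in>?K. cnj (dft x n k) * fourier_char n k j)" for j
  have S0: "S \<ge> 0"
    by (simp add: S_def sum_nonneg)
  have "complex_of_real S = (\<Sum>k\<in>?K. \<Sum>j=1..n. cnj (dft x n k) * fourier_char n k j * of_real (x j))"
    unfolding S_def of_real_sum complex_norm_square
    by (subst (1) dft_def) (simp add: sum_distrib_left sum_distrib_right mult_ac)
  also have "\<dots> = (\<Sum>j=1..n. v j * of_real (x j))"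
    unfolding v_def sum_distrib_right by (rule sum.swap)
  finally have "S = cmod (\<Sum>j=1..n. v j * of_real (x j))"
    using S0 by (metis abs_of_nonneg norm_of_real)
  also have "\<dots> \<le> (\<Sum>j=1..n. cmod (v j) * \<bar>x j\<bar>)"
    by (rule order_trans[OF norm_sum]) (simp add: norm_mult)
  finally have "S\<^sup>2 \<le> (\<Sum>j=1..n. cmod (v j) * \<bar>x j\<bar>)\<^sup>2"
    using S0 by (rule power_mono)
  also have "\<dots> \<le> (\<Sum>j=1..n. (cmod (v j))\<^sup>2) * (\<Sum>j=1..n. \<bar>x j\<bar>\<^sup>2)"
    by (rule Cauchy_Schwarz_ineq_sum)
  also have "(\<Sum>j=1..n. (cmod (v j))\<^sup>2) = real n * S"
    using fourier_char_parseval[where c = "\<lambda>k. cnj (dft x n k)" and n = n] by (simp add: v_def S_def)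
  finally have "S * S \<le> S * (real n * (\<Sum>j=1..n. (x j)\<^sup>2))"
    by (simp add: power2_eq_square mult_ac)
  then show ?thesis
    using S0 unfolding S_def[symmetric]
    by (cases "S = 0") (auto simp: sum_nonneg)
qed

section \<open>The Gaussian bump\<close>

definition gaussian_bump :: "real \<Rightarrow> complex \<Rightarrow> real" where
  "gaussian_bump m z = exp (- m * (cmod z)\<^sup>2)"

lemma gaussian_bump_nonneg: "0 \<le> gaussian_bump m z"
  by (simp add: gaussian_bump_def)

lemma gaussian_bump_le_1: "m \<ge> 0 \<Longrightarrow> gaussian_bump m z \<le> 1"
  by (simp add: gaussian_bump_def)

lemma exp_minus_le_inverse: "s \<ge> 0 \<Longrightarrow> exp (- s) \<le> 1 / (1 + (s::real))"
  using exp_ge_add_one_self[of s] by (simp add: exp_minus field_simps)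

lemma gaussian_bump_quadratic_decay:
  assumes "m \<ge> 0"
  shows "m * (cmod z)\<^sup>2 * gaussian_bump m z \<le> 1"
proof -
  let ?s = "m * (cmod z)\<^sup>2"
  have "?s * gaussian_bump m z \<le> ?s * (1 / (1 + ?s))"
    unfolding gaussian_bump_def using assms exp_minus_le_inverse[of ?s] by (intro mult_left_mono) auto
  also have "\<dots> \<le> 1"
    using assms by (simp add: divide_simps) (smt (verit) mult_nonneg_nonneg zero_le_power2)
  finally show ?thesis .
qed

lemma gaussian_bump_gradient_le:
  assumes "m \<ge> 0"
  shows "2 * m * gaussian_bump m z * cmod z \<le> sqrt m"
proof -
  let ?s = "sqrt m * cmod z"
  have m: "sqrt m * sqrt m = m" using assms by simp
  have s2: "?s\<^sup>2 = m * (cmod z)\<^sup>2" using assms by (simp add: power_mult_distrib)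
  have "gaussian_bump m z \<le> 1 / (1 + ?s\<^sup>2)"
    unfolding gaussian_bump_def s2 using assms exp_minus_le_inverse[of "m * (cmod z)\<^sup>2"] by simp
  then have "2 * ?s * gaussian_bump m z \<le> 2 * ?s * (1 / (1 + ?s\<^sup>2))"
    using assms by (intro mult_left_mono) auto
  also have "\<dots> \<le> 1"
    using sum_squares_bound[of 1 ?s] by (simp add: divide_simps add_pos_nonneg)
  finally have "sqrt m * (2 * ?s * gaussian_bump m z) \<le> sqrt m * 1"
    using assms by (intro mult_left_mono) auto
  moreover have "sqrt m * (2 * ?s * gaussian_bump m z) = 2 * (sqrt m * sqrt m) * gaussian_bump m z * cmod z"
    by (simp add: mult_ac)
  ultimately show ?thesis
    using m by simp
qed

text \<open>
  The first and second derivatives along a line, from which both the Lipschitz bound and the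
  Taylor bound are read off.
\<close>

lemma gaussian_bump_line:
  fixes z h :: complex and t m :: real
  defines "w \<equiv> z + of_real t * h"
  shows "((\<lambda>t. gaussian_bump m (z + of_real t * h)) has_real_derivative
           (- 2 * m * (w \<bullet> h) * gaussian_bump m w)) (at t)"
    and "((\<lambda>t. - 2 * m * ((z + of_real t * h) \<bullet> h) * gaussian_bump m (z + of_real t * h)) has_real_derivative
           ((4 * m\<^sup>2 * (w \<bullet> h)\<^sup>2 - 2 * m * (cmod h)\<^sup>2) * gaussian_bump m w)) (at t)"
  unfolding gaussian_bump_def w_def cmod_power2 inner_complex_def
  by (auto intro!: derivative_eq_intros simp: power2_eq_square algebra_simps)

lemma gaussian_bump_lipschitz:
  assumes "m \<ge> 0"
  shows "\<bar>gaussian_bump m (z + h) - gaussian_bump m z\<bar> \<le> sqrt m * cmod h"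
proof -
  define w where "w t = z + of_real t * h" for t :: real
  obtain t where t: "gaussian_bump m (w 1) - gaussian_bump m (w 0) =
      (1 - 0) * (- 2 * m * (w t \<bullet> h) * gaussian_bump m (w t))"
    using MVT2[of 0 1 "\<lambda>t. gaussian_bump m (w t)" "\<lambda>t. - 2 * m * (w t \<bullet> h) * gaussian_bump m (w t)"]
      gaussian_bump_line(1)[where z = z and h = h and m = m]
    by (auto simp: w_def)
  have "\<bar>gaussian_bump m (z + h) - gaussian_bump m z\<bar> = 2 * m * gaussian_bump m (w t) * \<bar>w t \<bullet> h\<bar>"
    using t assms by (simp add: w_def abs_mult gaussian_bump_nonneg mult_ac)
  also have "\<dots> \<le> 2 * m * gaussian_bump m (w t) * (cmod (w t) * cmod h)"
    using assms by (intro mult_left_mono Cauchy_Schwarz_ineq2) (auto simp: gaussian_bump_nonneg)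
  also have "\<dots> \<le> sqrt m * cmod h"
    using mult_right_mono[OF gaussian_bump_gradient_le[OF assms, of "w t"], of "cmod h"] by (simp add: mult_ac)
  finally show ?thesis .
qed

lemma gaussian_bump_taylor:
  assumes "m \<ge> 0"
  shows "\<bar>gaussian_bump m (z + h) - gaussian_bump m z + 2 * m * gaussian_bump m z * (z \<bullet> h)\<bar> \<le> 3 * m * (cmod h)\<^sup>2"
proof -
  define w where "w t = z + of_real t * h" for t :: real
  define D where "D i = (\<lambda>t. if i = 0 then gaussian_bump m (w t)
     else if i = 1 then - 2 * m * (w t \<bullet> h) * gaussian_bump m (w t)
     else (4 * m\<^sup>2 * (w t \<bullet> h)\<^sup>2 - 2 * m * (cmod h)\<^sup>2) * gaussian_bump m (w t))" for i :: nat
  have "\<forall>i t. i < 2 \<and> 0 \<le> t \<and> t \<le> 1 \<longrightarrow> DERIV (D i) t :> D (Suc i) t"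
    using gaussian_bump_line[where z = z and h = h and m = m]
    by (auto simp: D_def w_def less_2_cases_iff)
  then obtain t where t: "D 0 1 = (\<Sum>i<2. D i 0 / fact i * 1 ^ i) + D 2 t / fact 2 * 1 ^ 2"
    using Maclaurin2[of 1 D "D 0" 2] by auto
  have "gaussian_bump m (z + h) - gaussian_bump m z + 2 * m * gaussian_bump m z * (z \<bullet> h) = D 2 t / 2"
    using t by (simp add: D_def w_def numeral_2_eq_2)
  also have "\<bar>D 2 t / 2\<bar> \<le> 3 * m * (cmod h)\<^sup>2"
  proof -
    have g: "0 \<le> gaussian_bump m (w t)" "gaussian_bump m (w t) \<le> 1"
      using assms by (auto simp: gaussian_bump_nonneg gaussian_bump_le_1)
    have "m * (w t \<bullet> h)\<^sup>2 * gaussian_bump m (w t) \<le> m * ((cmod (w t))\<^sup>2 * (cmod h)\<^sup>2) * gaussian_bump m (w t)"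
      using Cauchy_Schwarz_ineq[of "w t" h] assms g
      by (intro mult_right_mono mult_left_mono) (auto simp: power2_norm_eq_inner)
    also have "\<dots> \<le> 1 * (cmod h)\<^sup>2"
      using mult_right_mono[OF gaussian_bump_quadratic_decay[OF assms, of "w t"], of "(cmod h)\<^sup>2"]
      by (simp add: mult_ac)
    finally have 1: "4 * m * (m * (w t \<bullet> h)\<^sup>2 * gaussian_bump m (w t)) \<le> 4 * m * (1 * (cmod h)\<^sup>2)"
      using assms by (intro mult_left_mono) auto
    have 2: "2 * m * (cmod h)\<^sup>2 * gaussian_bump m (w t) \<le> 2 * m * (cmod h)\<^sup>2 * 1"
      using assms g by (intro mult_left_mono) auto
    have 3: "0 \<le> 4 * m * (m * (w t \<bullet> h)\<^sup>2 * gaussian_bump m (w t))" "0 \<le> 2 * m * (cmod h)\<^sup>2 * gaussian_bump m (w t)"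
      using assms g by auto
    have "D 2 t = 4 * m * (m * (w t \<bullet> h)\<^sup>2 * gaussian_bump m (w t)) - 2 * m * (cmod h)\<^sup>2 * gaussian_bump m (w t)"
      by (simp add: D_def algebra_simps power2_eq_square)
    with 1 2 3 show ?thesis by linarith
  qed
  finally show ?thesis .
qed

section \<open>The Laplace transform of the empirical distribution\<close>

lemma num_freqs_bounds:
  assumes "n \<ge> 3"
  shows "0 < num_freqs n" "num_freqs n \<le> n" "n \<le> 4 * num_freqs n"
  using assms unfolding num_freqs_def by presburger+

definition scaled_dft :: "(nat \<Rightarrow> real) \<Rightarrow> nat \<Rightarrow> nat \<Rightarrow> complex" where
  "scaled_dft x n k = dft x n k / of_real (sqrt (real n))"

text \<open>
  The Laplace transform at \<open>m\<close> of the empirical distribution of the periodogram, equivalently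
  the \<open>m\<close>-th moment of the values \<open>exp (- I)\<close>.
\<close>

definition periodogram_laplace :: "real \<Rightarrow> (nat \<Rightarrow> real) \<Rightarrow> nat \<Rightarrow> real" where
  "periodogram_laplace m x n = 1 / real (num_freqs n) * (\<Sum>k=1..num_freqs n. gaussian_bump m (scaled_dft x n k))"

lemma gaussian_bump_scaled_dft:
  "gaussian_bump m (scaled_dft x n k) = exp (- m * periodogram x n (2 * pi * real k / real n))"
  by (simp add: gaussian_bump_def scaled_dft_def periodogram_eq_dft norm_divide power_divide)

lemma periodogram_laplace_bounds:
  assumes "m \<ge> 0"
  shows "\<bar>periodogram_laplace m x n\<bar> \<le> 1"
  using norm_average_le[of "num_freqs n" "\<lambda>k. gaussian_bump m (scaled_dft x n k)" 1] assms
  by (simp add: periodogram_laplace_def gaussian_bump_nonneg gaussian_bump_le_1)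

lemma scaled_dft_cong: "(\<And>j. j \<in> {1..n} \<Longrightarrow> x j = y j) \<Longrightarrow> scaled_dft x n k = scaled_dft y n k"
  by (simp add: scaled_dft_def dft_def)

lemma periodogram_laplace_cong:
  "(\<And>j. j \<in> {1..n} \<Longrightarrow> x j = y j) \<Longrightarrow> periodogram_laplace m x n = periodogram_laplace m y n"
  unfolding periodogram_laplace_def using scaled_dft_cong[of n x y] by simp

text \<open>
  The bump is Lipschitz with constant \<open>sqrt m\<close>; Cauchy--Schwarz over the frequencies and
  Bessel's inequality turn this into a bound by the Euclidean distance of the data.
\<close>

lemma periodogram_laplace_lipschitz:
  assumes m: "m \<ge> 0" and n: "n \<ge> 3"
  shows "(periodogram_laplace m x n - periodogram_laplace m y n)\<^sup>2 \<le>
           m / real (num_freqs n) * (\<Sum>j=1..n. (x j - y j)\<^sup>2)"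
proof -
  let ?r = "num_freqs n" and ?S = "\<Sum>j=1..n. (x j - y j)\<^sup>2"
  define d where "d k = cmod (dft (\<lambda>j. x j - y j) n k)" for k
  note r = num_freqs_bounds[OF n]
  have step: "\<bar>gaussian_bump m (scaled_dft x n k) - gaussian_bump m (scaled_dft y n k)\<bar> \<le> sqrt m * d k / sqrt (real n)" for k
  proof -
    have "scaled_dft x n k - scaled_dft y n k = dft (\<lambda>j. x j - y j) n k / of_real (sqrt (real n))"
      by (simp add: scaled_dft_def dft_diff[symmetric] diff_divide_distrib)
    then have "cmod (scaled_dft x n k - scaled_dft y n k) = d k / sqrt (real n)"
      by (simp add: d_def norm_divide)
    then show ?thesis
      using gaussian_bump_lipschitz[OF m, of "scaled_dft y n k" "scaled_dft x n k - scaled_dft y n k"] by simp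
  qed
  have "\<bar>periodogram_laplace m x n - periodogram_laplace m y n\<bar> =
      1 / real ?r * \<bar>\<Sum>k=1..?r. gaussian_bump m (scaled_dft x n k) - gaussian_bump m (scaled_dft y n k)\<bar>"
    by (simp add: periodogram_laplace_def sum_subtractf diff_divide_distrib[symmetric] abs_divide)
  also have "\<dots> \<le> 1 / real ?r * (\<Sum>k=1..?r. sqrt m * d k / sqrt (real n))"
    using step by (intro mult_left_mono order_trans[OF sum_abs] sum_mono) auto
  also have "\<dots> = sqrt m / (real ?r * sqrt (real n)) * (\<Sum>k=1..?r. d k)"
    by (simp add: sum_distrib_left sum_divide_distrib field_simps)
  finally have "\<bar>periodogram_laplace m x n - periodogram_laplace m y n\<bar>\<^sup>2 \<le>
      (sqrt m / (real ?r * sqrt (real n)) * (\<Sum>k=1..?r. d k))\<^sup>2"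
    by (intro power_mono) auto
  also have "\<dots> = m / ((real ?r)\<^sup>2 * real n) * (\<Sum>k=1..?r. d k)\<^sup>2"
    using m by (simp add: power_mult_distrib power_divide)
  also have "\<dots> \<le> m / ((real ?r)\<^sup>2 * real n) * (real ?r * (real n * ?S))"
  proof (rule mult_left_mono)
    have "(\<Sum>k=1..?r. 1 * d k)\<^sup>2 \<le> (\<Sum>k=1..?r. 1\<^sup>2) * (\<Sum>k=1..?r. (d k)\<^sup>2)"
      by (rule Cauchy_Schwarz_ineq_sum)
    also have "\<dots> \<le> real ?r * (real n * ?S)"
      using dft_bessel[of "\<lambda>j. x j - y j" n] by (simp add: d_def mult_left_mono)
    finally show "(\<Sum>k=1..?r. d k)\<^sup>2 \<le> real ?r * (real n * ?S)" by simp
  qed (use m in simp)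
  also have "\<dots> = m / real ?r * ?S"
    using r n by (simp add: power2_eq_square)
  finally show ?thesis by simp
qed

text \<open>
  With respect to the real inner product, the gradient of the bump at \<open>z\<close> is \<open>- 2 m g z\<close>, where
  \<open>g\<close> is the value of the bump.  Negated and conjugated it acts on a displacement by a complex
  product, which makes the sum over frequencies a trigonometric polynomial.
\<close>

definition laplace_gradient :: "real \<Rightarrow> (nat \<Rightarrow> real) \<Rightarrow> nat \<Rightarrow> nat \<Rightarrow> complex" where
  "laplace_gradient m x n k = of_real (2 * m * gaussian_bump m (scaled_dft x n k)) * cnj (scaled_dft x n k)"

lemma norm_laplace_gradient_le: "m \<ge> 0 \<Longrightarrow> (cmod (laplace_gradient m x n k))\<^sup>2 \<le> m"
proof -
  assume m: "m \<ge> 0"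
  have "cmod (laplace_gradient m x n k) \<le> sqrt m"
    using gaussian_bump_gradient_le[OF m, of "scaled_dft x n k"] m
    by (simp add: laplace_gradient_def norm_mult gaussian_bump_nonneg)
  then have "(cmod (laplace_gradient m x n k))\<^sup>2 \<le> (sqrt m)\<^sup>2"
    by (intro power_mono) auto
  with m show ?thesis by simp
qed

lemma dft_fun_upd:
  assumes "j \<in> {1..n}"
  shows "dft (x(j := t)) n k = dft x n k + fourier_char n k j * of_real (t - x j)"
proof -
  have "dft (x(j := t)) n k - dft x n k = (\<Sum>i=1..n. if i = j then fourier_char n k j * of_real (t - x j) else 0)"
    unfolding dft_diff unfolding dft_def by (intro sum.cong) auto
  then show ?thesis
    using assms by (simp add: algebra_simps)
qed

text \<open>
  A bound for the squared effect of changing observation \<open>j\<close> by at most \<open>sqrt D\<close>.  The first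
  summand is the squared linear term of the Taylor expansion, the second the squared remainder; each
  is doubled by \<open>(A - R)\<^sup>2 \<le> 2 A\<^sup>2 + 2 R\<^sup>2\<close>.  It depends only on the old data, as the
  Efron--Stein bound for squares requires.
\<close>

definition site_bound :: "real \<Rightarrow> nat \<Rightarrow> real \<Rightarrow> nat \<Rightarrow> (nat \<Rightarrow> real) \<Rightarrow> real" where
  "site_bound m n D j x =
     2 * D / ((real (num_freqs n))\<^sup>2 * real n) * (cmod (\<Sum>k=1..num_freqs n. laplace_gradient m x n k * fourier_char n k j))\<^sup>2
     + 18 * m\<^sup>2 * D\<^sup>2 / (real n)\<^sup>2"

lemma periodogram_laplace_site_change:
  assumes m: "m \<ge> 0" and n: "n \<ge> 3" and j: "j \<in> {1..n}" and D: "(t - x j)\<^sup>2 \<le> D"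
  shows "(periodogram_laplace m x n - periodogram_laplace m (x(j := t)) n)\<^sup>2 \<le> site_bound m n D j x"
proof -
  let ?r = "num_freqs n"
  define \<delta> where "\<delta> = t - x j"
  define h where "h k = fourier_char n k j * of_real (\<delta> / sqrt (real n))" for k
  define A where "A = 1 / real ?r * (\<Sum>k=1..?r. 2 * m * gaussian_bump m (scaled_dft x n k) * (scaled_dft x n k \<bullet> h k))"
  define R where "R = 1 / real ?r * (\<Sum>k=1..?r. gaussian_bump m (scaled_dft x n k + h k) - gaussian_bump m (scaled_dft x n k)
      + 2 * m * gaussian_bump m (scaled_dft x n k) * (scaled_dft x n k \<bullet> h k))"
  note r = num_freqs_bounds[OF n]
  have D0: "D \<ge> 0" using D zero_le_power2 order_trans by blast
  have zupd: "scaled_dft (x(j := t)) n k = scaled_dft x n k + h k" for k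
    by (simp add: scaled_dft_def dft_fun_upd[OF j] h_def \<delta>_def add_divide_distrib)
  have h2: "(cmod (h k))\<^sup>2 = \<delta>\<^sup>2 / real n" for k
    using n by (simp add: h_def norm_mult norm_divide power_divide)
  have "periodogram_laplace m x n - periodogram_laplace m (x(j := t)) n = A - R"
    unfolding periodogram_laplace_def zupd A_def R_def
    by (simp add: sum_subtractf sum.distrib algebra_simps add_divide_distrib diff_divide_distrib)
  moreover have "(A - R)\<^sup>2 \<le> 2 * A\<^sup>2 + 2 * R\<^sup>2"
    using zero_le_power2[of "A + R"] by (simp add: power2_eq_square algebra_simps)
  moreover have "A\<^sup>2 \<le> D / ((real ?r)\<^sup>2 * real n) * (cmod (\<Sum>k=1..?r. laplace_gradient m x n k * fourier_char n k j))\<^sup>2"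
  proof -
    let ?S = "\<Sum>k=1..?r. laplace_gradient m x n k * fourier_char n k j"
    have "2 * m * gaussian_bump m (scaled_dft x n k) * (scaled_dft x n k \<bullet> h k) =
        \<delta> / sqrt (real n) * Re (laplace_gradient m x n k * fourier_char n k j)" for k
      by (simp add: laplace_gradient_def inner_complex_def h_def algebra_simps diff_divide_distrib add_divide_distrib)
    then have "A = 1 / real ?r * (\<delta> / sqrt (real n) * Re ?S)"
      unfolding A_def Re_sum sum_distrib_left by simp
    then have "A = \<delta> / (real ?r * sqrt (real n)) * Re ?S"
      by simp
    then have "A\<^sup>2 = \<delta>\<^sup>2 / ((real ?r)\<^sup>2 * real n) * (Re ?S)\<^sup>2"
      by (simp add: power_mult_distrib power_divide)
    also have "\<dots> \<le> D / ((real ?r)\<^sup>2 * real n) * (cmod ?S)\<^sup>2"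
      using D D0 by (intro mult_mono divide_right_mono) (auto simp: \<delta>_def cmod_power2)
    finally show ?thesis .
  qed
  moreover have "R\<^sup>2 \<le> (3 * m * (D / real n))\<^sup>2"
  proof -
    have "\<bar>R\<bar> \<le> 3 * m * (D / real n)"
      unfolding R_def
    proof (rule norm_average_le[where 'a = real, unfolded real_norm_def])
      fix k
      have "\<bar>gaussian_bump m (scaled_dft x n k + h k) - gaussian_bump m (scaled_dft x n k) + 2 * m * gaussian_bump m (scaled_dft x n k) * (scaled_dft x n k \<bullet> h k)\<bar>
          \<le> 3 * m * (cmod (h k))\<^sup>2"
        by (rule gaussian_bump_taylor[OF m])
      also have "\<dots> \<le> 3 * m * (D / real n)"
        unfolding h2 using D m by (intro mult_left_mono divide_right_mono) (auto simp: \<delta>_def)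
      finally show "\<bar>gaussian_bump m (scaled_dft x n k + h k) - gaussian_bump m (scaled_dft x n k) + 2 * m * gaussian_bump m (scaled_dft x n k) * (scaled_dft x n k \<bullet> h k)\<bar>
          \<le> 3 * m * (D / real n)" .
    qed (use m D0 in simp)
    then show ?thesis
      by (metis abs_ge_zero power2_abs power_mono)
  qed
  ultimately show ?thesis
    by (simp add: site_bound_def power_mult_distrib power_divide)
qed

text \<open>
  By Parseval the linear terms, each of which could be of order \<open>1 / n\<close> when squared, sum to
  order \<open>1 / n\<close> over all observations together.
\<close>

lemma sum_site_bound_le:
  assumes m: "m \<ge> 0" and n: "n \<ge> 3" and D: "D \<ge> 0"
  shows "(\<Sum>j=1..n. site_bound m n D j x) \<le> (2 * D * m + 18 * m\<^sup>2 * D\<^sup>2) / real (num_freqs n)"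
proof -
  let ?r = "num_freqs n"
  note r = num_freqs_bounds[OF n]
  have "(\<Sum>j=1..n. site_bound m n D j x) =
      2 * D / ((real ?r)\<^sup>2 * real n) * (real n * (\<Sum>k=1..?r. (cmod (laplace_gradient m x n k))\<^sup>2))
      + real n * (18 * m\<^sup>2 * D\<^sup>2 / (real n)\<^sup>2)"
    unfolding site_bound_def sum.distrib sum_distrib_left[symmetric] fourier_char_parseval by simp
  also have "\<dots> \<le> 2 * D / ((real ?r)\<^sup>2 * real n) * (real n * (\<Sum>k=1..?r. m))
      + real n * (18 * m\<^sup>2 * D\<^sup>2 / (real n)\<^sup>2)"
    using norm_laplace_gradient_le[OF m] D
    by (intro add_mono mult_left_mono sum_mono) auto
  also have "\<dots> = 2 * D * m / real ?r + 18 * m\<^sup>2 * D\<^sup>2 / real n"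
    using r n by (simp add: power2_eq_square)
  also have "\<dots> \<le> 2 * D * m / real ?r + 18 * m\<^sup>2 * D\<^sup>2 / real ?r"
    using r m D by (intro add_mono divide_left_mono) auto
  finally show ?thesis
    by (simp add: add_divide_distrib)
qed

section \<open>Convergence of the expected Laplace transform\<close>

lemma (in prob_space) char_third_moment_bound:
  fixes X :: "'a \<Rightarrow> real"
  assumes [measurable]: "X \<in> borel_measurable M"
    and int2: "integrable M (\<lambda>\<omega>. (X \<omega>)\<^sup>2)" and int3: "integrable M (\<lambda>\<omega>. \<bar>X \<omega>\<bar> ^ 3)"
    and m1: "expectation X = 0" and m2: "expectation (\<lambda>\<omega>. (X \<omega>)\<^sup>2) = 1"
    and m3: "expectation (\<lambda>\<omega>. \<bar>X \<omega>\<bar> ^ 3) \<le> C"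
  shows "cmod (char (distr M borel X) t - (1 - t\<^sup>2 / 2)) \<le> \<bar>t\<bar> ^ 3 / 6 * C"
proof -
  have int1: "integrable M X"
    using square_integrable_imp_integrable[OF assms(1) int2] .
  have "variance X = 1"
    using int1 int2 by (simp add: variance_eq m1 m2)
  from char_approx3'[OF assms(1) int1 int2 m1 this refl, of t]
  have "cmod (char (distr M borel X) t - (1 - t\<^sup>2 / 2)) \<le>
      t\<^sup>2 / 6 * expectation (\<lambda>\<omega>. min (6 * (X \<omega>)\<^sup>2) (\<bar>t\<bar> * \<bar>X \<omega>\<bar> ^ 3))"
    by simp
  also have "\<dots> \<le> t\<^sup>2 / 6 * (\<bar>t\<bar> * C)"
  proof (rule mult_left_mono)
    have "integrable M (\<lambda>\<omega>. min (6 * (X \<omega>)\<^sup>2) (\<bar>t\<bar> * \<bar>X \<omega>\<bar> ^ 3))"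
      using int2 int3 by (intro integrable_min) auto
    then have "expectation (\<lambda>\<omega>. min (6 * (X \<omega>)\<^sup>2) (\<bar>t\<bar> * \<bar>X \<omega>\<bar> ^ 3)) \<le> expectation (\<lambda>\<omega>. \<bar>t\<bar> * \<bar>X \<omega>\<bar> ^ 3)"
      using int3 by (intro integral_mono) auto
    also have "\<dots> \<le> \<bar>t\<bar> * C"
      using m3 by (simp add: mult_left_mono)
    finally show "expectation (\<lambda>\<omega>. min (6 * (X \<omega>)\<^sup>2) (\<bar>t\<bar> * \<bar>X \<omega>\<bar> ^ 3)) \<le> \<bar>t\<bar> * C" .
  qed simp
  also have "\<dots> = \<bar>t\<bar> ^ 3 / 6 * C"
  proof -
    have "\<bar>t\<bar> ^ 3 = t\<^sup>2 * \<bar>t\<bar>"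
      by (simp add: power3_eq_cube power2_eq_square)
    then show ?thesis by simp
  qed
  finally show ?thesis .
qed

lemma prob_space_std_normal: "prob_space std_normal_distribution"
  by (rule prob_space_normal_density) simp

text \<open>
  The bound \<open>char_third_moment_bound\<close> for the standard normal distribution, whose characteristic function is
  \<open>exp (- t\<^sup>2 / 2)\<close> and whose third absolute moment is \<open>2 sqrt (2 / \<pi>) \<le> 2\<close>.
\<close>

lemma gaussian_exp_bound: "cmod (complex_of_real (exp (- (t\<^sup>2) / 2)) - (1 - t\<^sup>2 / 2)) \<le> \<bar>t\<bar> ^ 3 / 3"
proof -
  interpret N: prob_space std_normal_distribution by (rule prob_space_std_normal)
  have "cmod (char (distr std_normal_distribution borel (\<lambda>x. x)) t - (1 - t\<^sup>2 / 2)) \<le> \<bar>t\<bar> ^ 3 / 6 * 2"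
  proof (rule N.char_third_moment_bound)
    show "N.expectation (\<lambda>x. x) = 0"
      using integral_std_normal_distribution_moment_odd[of 1] by simp
    show "N.expectation (\<lambda>x. x\<^sup>2) = 1"
      using std_normal_distribution_even_moments[of 1] by simp
    have "sqrt (2 / pi) \<le> 1"
      using pi_gt3 by simp
    then show "N.expectation (\<lambda>x. \<bar>x\<bar> ^ 3) \<le> 2"
      using std_normal_distribution_odd_moments_abs[of 1] by simp
    show "integrable std_normal_distribution (\<lambda>x. x\<^sup>2)"
      by (rule integrable_std_normal_distribution_moment)
    show "integrable std_normal_distribution (\<lambda>x. \<bar>x\<bar> ^ 3)"
      using integrable_abs[OF integrable_std_normal_distribution_moment[of 3]]
      by (simp add: power_abs)
  qed simp
  moreover have "distr std_normal_distribution borel (\<lambda>x. x) = std_normal_distribution"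
    by (rule distr_id2) simp
  ultimately show ?thesis
    by (simp add: char_std_normal_distribution exp_of_real)
qed

lemma (in prob_space) expectation_iexp_sum:
  fixes X :: "'i \<Rightarrow> 'a \<Rightarrow> real"
  assumes indep: "indep_vars (\<lambda>_. borel) X I"
  shows "(CLINT \<omega>|M. iexp (\<Sum>j\<in>I. t j * X j \<omega>)) = (\<Prod>j\<in>I. char (distr M borel (X j)) (t j))"
proof -
  have X: "X j \<in> borel_measurable M" if "j \<in> I" for j
    using indep that by (auto simp: indep_vars_def)
  have tX: "indep_vars (\<lambda>_. borel) (\<lambda>j \<omega>. t j * X j \<omega>) I"
    by (rule indep_vars_compose2[OF indep]) auto
  have "(\<lambda>\<omega>. \<Sum>j\<in>I. t j * X j \<omega>) \<in> borel_measurable M"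
    using X by (intro borel_measurable_sum borel_measurable_times) auto
  then have "(CLINT \<omega>|M. iexp (\<Sum>j\<in>I. t j * X j \<omega>)) = char (distr M borel (\<lambda>\<omega>. \<Sum>j\<in>I. t j * X j \<omega>)) 1"
    by (simp add: char_def integral_distr)
  also have "\<dots> = (\<Prod>j\<in>I. char (distr M borel (\<lambda>\<omega>. t j * X j \<omega>)) 1)"
    by (rule char_distr_sum[OF tX])
  also have "\<dots> = (\<Prod>j\<in>I. char (distr M borel (X j)) (t j))"
    using X by (intro prod.cong refl) (simp add: char_def integral_distr)
  finally show ?thesis .
qed

text \<open>
  Both terms are products over \<open>j\<close> of numbers in the unit disc, so the factors can be compared
  one at a time.  Both factors with index \<open>j\<close> differ from \<open>1 - (t j)\<^sup>2 / 2\<close> by at most a multiple of \<open>|t j|\<^sup>3\<close>.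
\<close>

lemma (in prob_space) expectation_iexp_sum_gaussian:
  fixes X :: "'i \<Rightarrow> 'a \<Rightarrow> real"
  assumes indep: "indep_vars (\<lambda>_. borel) X I"
    and m1: "\<And>j. j \<in> I \<Longrightarrow> expectation (X j) = 0"
    and m2: "\<And>j. j \<in> I \<Longrightarrow> expectation (\<lambda>\<omega>. (X j \<omega>)\<^sup>2) = 1"
    and int3: "\<And>j. j \<in> I \<Longrightarrow> integrable M (\<lambda>\<omega>. \<bar>X j \<omega>\<bar> ^ 3)"
    and m3: "\<And>j. j \<in> I \<Longrightarrow> expectation (\<lambda>\<omega>. \<bar>X j \<omega>\<bar> ^ 3) \<le> C"
  shows "cmod ((CLINT \<omega>|M. iexp (\<Sum>j\<in>I. t j * X j \<omega>)) - complex_of_real (exp (- (\<Sum>j\<in>I. (t j)\<^sup>2) / 2)))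
           \<le> (C + 2) / 6 * (\<Sum>j\<in>I. \<bar>t j\<bar> ^ 3)"
proof -
  have X: "X j \<in> borel_measurable M" if "j \<in> I" for j
    using indep that by (auto simp: indep_vars_def)
  have int2: "integrable M (\<lambda>\<omega>. (X j \<omega>)\<^sup>2)" if "j \<in> I" for j
    using m2[OF that] not_integrable_integral_eq by fastforce
  define \<psi> where "\<psi> j = char (distr M borel (X j)) (t j)" for j
  define \<gamma> where "\<gamma> j = complex_of_real (exp (- ((t j)\<^sup>2) / 2))" for j
  have "complex_of_real (exp (- (\<Sum>j\<in>I. (t j)\<^sup>2) / 2)) = (\<Prod>j\<in>I. \<gamma> j)"
  proof (cases "finite I")
    case True
    then show ?thesis
      unfolding \<gamma>_def of_real_prod[symmetric] exp_sum[OF True, symmetric]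
      by (simp add: sum_negf sum_divide_distrib)
  qed (simp add: \<gamma>_def)
  then have "cmod ((CLINT \<omega>|M. iexp (\<Sum>j\<in>I. t j * X j \<omega>)) - complex_of_real (exp (- (\<Sum>j\<in>I. (t j)\<^sup>2) / 2)))
      = cmod ((\<Prod>j\<in>I. \<psi> j) - (\<Prod>j\<in>I. \<gamma> j))"
    by (simp only: expectation_iexp_sum[OF indep] \<psi>_def)
  also have "\<dots> \<le> (\<Sum>j\<in>I. cmod (\<psi> j - \<gamma> j))"
  proof (rule norm_prod_diff)
    fix j assume "j \<in> I"
    then show "norm (\<psi> j) \<le> 1"
      unfolding \<psi>_def using X by (intro real_distribution.cmod_char_le_1 real_distribution_distr)
    show "norm (\<gamma> j) \<le> 1"
      by (simp add: \<gamma>_def del: of_real_exp)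
  qed
  also have "\<dots> \<le> (\<Sum>j\<in>I. (C + 2) / 6 * \<bar>t j\<bar> ^ 3)"
  proof (rule sum_mono)
    fix j assume j: "j \<in> I"
    have "cmod (\<psi> j - \<gamma> j) \<le> cmod (\<psi> j - (1 - (t j)\<^sup>2 / 2)) + cmod (\<gamma> j - (1 - (t j)\<^sup>2 / 2))"
      using norm_triangle_ineq4[of "\<psi> j - (1 - (t j)\<^sup>2 / 2)" "\<gamma> j - (1 - (t j)\<^sup>2 / 2)"] by simp
    also have "\<dots> \<le> \<bar>t j\<bar> ^ 3 / 6 * C + \<bar>t j\<bar> ^ 3 / 3"
      unfolding \<psi>_def \<gamma>_def
      using char_third_moment_bound[OF X[OF j] int2[OF j] int3[OF j] m1[OF j] m2[OF j] m3[OF j]]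
        gaussian_exp_bound[of "t j"]
      by (intro add_mono) auto
    also have "\<dots> = (C + 2) / 6 * \<bar>t j\<bar> ^ 3"
      by (simp add: field_simps)
    finally show "cmod (\<psi> j - \<gamma> j) \<le> (C + 2) / 6 * \<bar>t j\<bar> ^ 3" .
  qed
  finally show ?thesis
    by (simp add: sum_distrib_left)
qed

abbreviation normal_pair :: "(real \<times> real) measure" where
  "normal_pair \<equiv> std_normal_distribution \<Otimes>\<^sub>M std_normal_distribution"

lemma prob_space_normal_pair: "prob_space normal_pair"
  by (intro prob_space_pair prob_space_std_normal)

text \<open>
  The Gaussian is its own Fourier transform.  This trades the nonlinear function of the data for
  characters, whose expectations factorise over independent observations.
\<close>

lemma gaussian_bump_eq_gaussian_average:
  assumes "m \<ge> 0"
  shows "complex_of_real (gaussian_bump m z) =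
           (CLINT w|normal_pair. iexp (sqrt (2 * m) * (fst w * Re z + snd w * Im z)))"
proof -
  interpret N: prob_space std_normal_distribution by (rule prob_space_std_normal)
  interpret NN: pair_prob_space std_normal_distribution std_normal_distribution ..
  let ?s = "sqrt (2 * m)"
  have int: "integrable normal_pair (\<lambda>w. iexp (?s * (fst w * Re z + snd w * Im z)))"
    by (intro NN.integrable_iexp) measurable
  have "(CLINT w|normal_pair. iexp (?s * (fst w * Re z + snd w * Im z))) =
      (CLINT u|std_normal_distribution. (CLINT v|std_normal_distribution.
         iexp (?s * (u * Re z + v * Im z))))"
    using NN.integral_fst'[OF int] by simp
  also have "\<dots> = (CLINT u|std_normal_distribution. (CLINT v|std_normal_distribution.
         iexp ((?s * Re z) * u) * iexp ((?s * Im z) * v)))"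
    by (intro Bochner_Integration.integral_cong refl) (simp add: exp_add[symmetric] algebra_simps)
  also have "\<dots> = char std_normal_distribution (?s * Re z) * char std_normal_distribution (?s * Im z)"
    by (simp add: char_def)
  also have "\<dots> = complex_of_real (exp (- (?s * Re z)\<^sup>2 / 2) * exp (- (?s * Im z)\<^sup>2 / 2))"
    by (simp add: char_std_normal_distribution exp_of_real)
  also have "exp (- (?s * Re z)\<^sup>2 / 2) * exp (- (?s * Im z)\<^sup>2 / 2) = gaussian_bump m z"
    using assms by (simp add: gaussian_bump_def exp_add[symmetric] power_mult_distrib cmod_power2 algebra_simps)
  finally show ?thesis ..
qed

lemma (in prob_space) expectation_gaussian_bump_eq:
  assumes [measurable]: "Z \<in> borel_measurable M" and m: "m \<ge> 0"
  shows "complex_of_real (expectation (\<lambda>\<omega>. gaussian_bump m (Z \<omega>))) =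
     (CLINT w|normal_pair. (CLINT \<omega>|M. iexp (sqrt (2 * m) * (fst w * Re (Z \<omega>) + snd w * Im (Z \<omega>)))))"
proof -
  interpret NN: prob_space normal_pair by (rule prob_space_normal_pair)
  interpret MN: pair_prob_space M normal_pair ..
  have [measurable]: "(\<lambda>\<omega>. Re (Z \<omega>)) \<in> borel_measurable M" "(\<lambda>\<omega>. Im (Z \<omega>)) \<in> borel_measurable M"
    by (auto intro: borel_measurable_continuous_on continuous_intros)
  have int: "integrable (M \<Otimes>\<^sub>M normal_pair)
      (\<lambda>(\<omega>, w). iexp (sqrt (2 * m) * (fst w * Re (Z \<omega>) + snd w * Im (Z \<omega>))))"
    unfolding case_prod_beta' by (intro MN.integrable_iexp) measurable
  have "complex_of_real (expectation (\<lambda>\<omega>. gaussian_bump m (Z \<omega>))) = (CLINT \<omega>|M. complex_of_real (gaussian_bump m (Z \<omega>)))"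
    by simp
  also have "\<dots> = (CLINT \<omega>|M. (CLINT w|normal_pair. iexp (sqrt (2 * m) * (fst w * Re (Z \<omega>) + snd w * Im (Z \<omega>)))))"
    using gaussian_bump_eq_gaussian_average[OF m] by simp
  also have "\<dots> = (CLINT w|normal_pair. (CLINT \<omega>|M. iexp (sqrt (2 * m) * (fst w * Re (Z \<omega>) + snd w * Im (Z \<omega>)))))"
    using MN.Fubini_integral[OF int] by simp
  finally show ?thesis .
qed

text \<open>
  Multiplied by the standard normal density, the integrand becomes \<open>1 / sqrt (1 + m)\<close> times the
  density of the centred normal law with variance \<open>1 / (1 + m)\<close>.
\<close>

lemma gaussian_laplace:
  assumes "m \<ge> 0"
  shows "(LINT u|std_normal_distribution. exp (- m * u\<^sup>2 / 2)) = 1 / sqrt (1 + m)"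
proof -
  define \<sigma> where "\<sigma> = 1 / sqrt (1 + m)"
  have s: "\<sigma> > 0" "\<sigma>\<^sup>2 = 1 / (1 + m)" using assms by (auto simp: \<sigma>_def power_divide)
  have "std_normal_density u * exp (- m * u\<^sup>2 / 2) = \<sigma> * normal_density 0 \<sigma> u" for u
  proof -
    have "exp (- u\<^sup>2 / 2) * exp (- m * u\<^sup>2 / 2) = exp (- u\<^sup>2 / (2 * \<sigma>\<^sup>2))"
      using assms by (simp add: exp_add[symmetric] s field_simps)
    moreover have "sqrt (2 * pi * \<sigma>\<^sup>2) = sqrt (2 * pi) * \<sigma>"
      using s(1) by (simp add: real_sqrt_mult)
    ultimately show ?thesis
      using s(1) by (simp add: normal_density_def)
  qed
  then have "(LINT u|std_normal_distribution. exp (- m * u\<^sup>2 / 2)) = (LINT u|lborel. \<sigma> * normal_density 0 \<sigma> u)"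
    by (subst integral_density) auto
  also have "\<dots> = \<sigma>"
    using s(1) by simp
  finally show ?thesis by (simp add: \<sigma>_def)
qed

lemma gaussian_pair_laplace:
  assumes "m \<ge> 0"
  shows "(LINT w|normal_pair. exp (- m * ((fst w)\<^sup>2 + (snd w)\<^sup>2) / 2)) = 1 / (m + 1)"
proof -
  interpret N: prob_space std_normal_distribution by (rule prob_space_std_normal)
  interpret NN: pair_prob_space std_normal_distribution std_normal_distribution ..
  have split: "exp (- m * ((fst w)\<^sup>2 + (snd w)\<^sup>2) / 2) =
      exp (- m * (fst w)\<^sup>2 / 2) * exp (- m * (snd w)\<^sup>2 / 2)" for w :: "real \<times> real"
    by (simp add: exp_add[symmetric] algebra_simps add_divide_distrib diff_divide_distrib)
  have int: "integrable normal_pair (\<lambda>w. exp (- m * ((fst w)\<^sup>2 + (snd w)\<^sup>2) / 2))"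
    using assms by (intro NN.integrable_const_bound[where B = 1]) (auto intro!: mult_nonneg_nonneg)
  have "(LINT w|normal_pair. exp (- m * ((fst w)\<^sup>2 + (snd w)\<^sup>2) / 2)) =
     (LINT u|std_normal_distribution. (LINT v|std_normal_distribution. exp (- m * u\<^sup>2 / 2) * exp (- m * v\<^sup>2 / 2)))"
    using NN.integral_fst'[OF int] unfolding split by simp
  also have "\<dots> = 1 / sqrt (1 + m) * (1 / sqrt (1 + m))"
    using gaussian_laplace[OF assms] by simp
  also have "\<dots> = 1 / (m + 1)"
    using assms by (simp add: add.commute)
  finally show ?thesis .
qed

text \<open>
  The square of a real part is \<open>(|c|\<^sup>2 + Re (c\<^sup>2)) / 2\<close>, and the squares of the characters sum
  to 0.  So every projection of a Fourier coefficient has the same variance.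
\<close>

lemma fourier_char_projection_sum:
  assumes "k \<in> {1..num_freqs n}"
  shows "(\<Sum>j=1..n. (u * Re (fourier_char n k j) + v * Im (fourier_char n k j))\<^sup>2) = real n * (u\<^sup>2 + v\<^sup>2) / 2"
proof -
  define w where "w = Complex u v"
  have "(u * Re (fourier_char n k j) + v * Im (fourier_char n k j))\<^sup>2 =
      (u\<^sup>2 + v\<^sup>2) / 2 + Re ((cnj w)\<^sup>2 * (fourier_char n k j)\<^sup>2) / 2" for j
  proof -
    have "(Re (fourier_char n k j))\<^sup>2 + (Im (fourier_char n k j))\<^sup>2 = 1"
      using norm_fourier_char[of n k j] by (simp add: cmod_def)
    moreover have "(u * a + v * b)\<^sup>2 = (u\<^sup>2 + v\<^sup>2) * (a\<^sup>2 + b\<^sup>2) / 2 + Re ((cnj w)\<^sup>2 * (Complex a b)\<^sup>2) / 2" for a b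
      by (simp add: w_def power2_eq_square algebra_simps)
        (simp add: field_simps)
    from this[of "Re (fourier_char n k j)" "Im (fourier_char n k j)"]
    have "(u * Re (fourier_char n k j) + v * Im (fourier_char n k j))\<^sup>2 =
      (u\<^sup>2 + v\<^sup>2) * ((Re (fourier_char n k j))\<^sup>2 + (Im (fourier_char n k j))\<^sup>2) / 2 + Re ((cnj w)\<^sup>2 * (fourier_char n k j)\<^sup>2) / 2"
      by simp
    ultimately show ?thesis by simp
  qed
  then have "(\<Sum>j=1..n. (u * Re (fourier_char n k j) + v * Im (fourier_char n k j))\<^sup>2) =
      real n * ((u\<^sup>2 + v\<^sup>2) / 2) + Re ((cnj w)\<^sup>2 * (\<Sum>j=1..n. (fourier_char n k j)\<^sup>2)) / 2"
    by (simp only: sum.distrib sum_distrib_left Re_sum sum_divide_distrib) simp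
  then show ?thesis
    unfolding sum_fourier_char_square_eq_0[OF assms] by simp
qed

lemma abs_fourier_char_projection_le: "\<bar>u * Re (fourier_char n k j) + v * Im (fourier_char n k j)\<bar> \<le> \<bar>u\<bar> + \<bar>v\<bar>"
proof -
  have "\<bar>Re (fourier_char n k j)\<bar> \<le> 1" "\<bar>Im (fourier_char n k j)\<bar> \<le> 1"
    using abs_Re_le_cmod[of "fourier_char n k j"] abs_Im_le_cmod[of "fourier_char n k j"] by auto
  from mult_left_mono[OF this(1), of "\<bar>u\<bar>"] mult_left_mono[OF this(2), of "\<bar>v\<bar>"]
  have "\<bar>u * Re (fourier_char n k j)\<bar> \<le> \<bar>u\<bar>" "\<bar>v * Im (fourier_char n k j)\<bar> \<le> \<bar>v\<bar>"
    by (simp_all add: abs_mult)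
  then show ?thesis by linarith
qed

lemma scaled_dft_projection:
  "u * Re (scaled_dft x n k) + v * Im (scaled_dft x n k) =
     (\<Sum>j=1..n. (u * Re (fourier_char n k j) + v * Im (fourier_char n k j)) / sqrt (real n) * x j)"
proof -
  have "scaled_dft x n k = (\<Sum>j=1..n. of_real (x j / sqrt (real n)) * fourier_char n k j)"
    by (simp add: scaled_dft_def dft_def sum_divide_distrib mult.commute)
  then show ?thesis
    by (simp add: sum_distrib_left sum.distrib[symmetric] algebra_simps add_divide_distrib)
qed

lemma scaled_dft_measurable:
  assumes "\<And>j. j \<in> {1..n} \<Longrightarrow> (\<lambda>\<omega>. X j \<omega>) \<in> borel_measurable M"
  shows "(\<lambda>\<omega>. scaled_dft (\<lambda>j. X j \<omega>) n k) \<in> borel_measurable M"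
  unfolding scaled_dft_def dft_def
  using assms by (intro borel_measurable_divide borel_measurable_sum borel_measurable_times
      borel_measurable_of_real) auto

lemma periodogram_laplace_measurable:
  assumes "\<And>j. j \<in> {1..n} \<Longrightarrow> (\<lambda>\<omega>. X j \<omega>) \<in> borel_measurable M"
  shows "(\<lambda>\<omega>. periodogram_laplace m (\<lambda>j. X j \<omega>) n) \<in> borel_measurable M"
  unfolding periodogram_laplace_def gaussian_bump_def
  using scaled_dft_measurable[OF assms] by measurable

context prob_space
begin

text \<open>
  A projection of a Fourier coefficient is a weighted sum of the observations with weights of
  order \<open>1 / sqrt n\<close>.  The squared weights add up exactly to the Gaussian exponent, and the cubed weights add
  up to order \<open>1 / sqrt n\<close>, uniformly in the frequency.
\<close>

lemma scaled_dft_projection_gaussian: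
  fixes X :: "nat \<Rightarrow> 'a \<Rightarrow> real"
  assumes indep: "indep_vars (\<lambda>_. borel) X {1..}"
    and m1: "\<And>j. j \<ge> 1 \<Longrightarrow> expectation (X j) = 0"
    and m2: "\<And>j. j \<ge> 1 \<Longrightarrow> expectation (\<lambda>\<omega>. (X j \<omega>)\<^sup>2) = 1"
    and int3: "\<And>j. j \<ge> 1 \<Longrightarrow> integrable M (\<lambda>\<omega>. \<bar>X j \<omega>\<bar> ^ 3)"
    and m3: "\<And>j. j \<ge> 1 \<Longrightarrow> expectation (\<lambda>\<omega>. \<bar>X j \<omega>\<bar> ^ 3) \<le> C"
    and m: "m \<ge> 0" and C: "C \<ge> 0" and n: "n \<ge> 3" and k: "k \<in> {1..num_freqs n}"
  shows "cmod ((CLINT \<omega>|M. iexp (sqrt (2 * m) * (u * Re (scaled_dft (\<lambda>j. X j \<omega>) n k) + v * Im (scaled_dft (\<lambda>j. X j \<omega>) n k))))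
            - complex_of_real (exp (- m * (u\<^sup>2 + v\<^sup>2) / 2)))
          \<le> (C + 2) / 6 * (sqrt (2 * m) * (\<bar>u\<bar> + \<bar>v\<bar>)) ^ 3 / sqrt (real n)"
proof -
  define t where "t j = sqrt (2 * m) * ((u * Re (fourier_char n k j) + v * Im (fourier_char n k j)) / sqrt (real n))" for j
  have n0: "real n > 0" using n by simp
  have "indep_vars (\<lambda>_. borel) X {1..n}"
    by (rule indep_vars_subset[OF indep]) auto
  note est = expectation_iexp_sum_gaussian[OF this m1 m2 int3 m3, of t]
  have s: "(\<Sum>j=1..n. t j * X j \<omega>) =
      sqrt (2 * m) * (u * Re (scaled_dft (\<lambda>j. X j \<omega>) n k) + v * Im (scaled_dft (\<lambda>j. X j \<omega>) n k))" for \<omega>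
    unfolding scaled_dft_projection t_def by (simp add: sum_distrib_left mult.assoc)
  have "(\<Sum>j=1..n. (t j)\<^sup>2) = 2 * m / real n * (\<Sum>j=1..n. (u * Re (fourier_char n k j) + v * Im (fourier_char n k j))\<^sup>2)"
    using m by (simp add: t_def power_mult_distrib power_divide sum_distrib_left)
  also have "\<dots> = m * (u\<^sup>2 + v\<^sup>2)"
    unfolding fourier_char_projection_sum[OF k] using n0 by simp
  finally have t2: "(\<Sum>j=1..n. (t j)\<^sup>2) = m * (u\<^sup>2 + v\<^sup>2)" .
  have "(\<Sum>j=1..n. \<bar>t j\<bar> ^ 3) \<le> (\<Sum>j=1..n. (sqrt (2 * m) * ((\<bar>u\<bar> + \<bar>v\<bar>) / sqrt (real n))) ^ 3)"
  proof (intro sum_mono power_mono)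
    fix j
    show "\<bar>t j\<bar> \<le> sqrt (2 * m) * ((\<bar>u\<bar> + \<bar>v\<bar>) / sqrt (real n))"
      unfolding t_def abs_mult abs_divide
      using m abs_fourier_char_projection_le[of u n k j v] by (auto intro!: mult_left_mono divide_right_mono)
  qed simp
  also have "\<dots> = (sqrt (2 * m) * (\<bar>u\<bar> + \<bar>v\<bar>)) ^ 3 / sqrt (real n)"
  proof -
    have "sqrt (real n) ^ 3 = real n * sqrt (real n)"
      by (simp add: power3_eq_cube)
    then show ?thesis
      using n0 by (simp add: power_mult_distrib power_divide)
  qed
  finally have "(C + 2) / 6 * (\<Sum>j=1..n. \<bar>t j\<bar> ^ 3) \<le> (C + 2) / 6 * ((sqrt (2 * m) * (\<bar>u\<bar> + \<bar>v\<bar>)) ^ 3 / sqrt (real n))"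
    using C by (intro mult_left_mono) auto
  then show ?thesis
    using est unfolding s t2 by simp
qed

text \<open>
  Averaging over the frequencies before integrating over the mixing variable \<open>w\<close> leaves, for
  each fixed \<open>w\<close>, a sequence of numbers in the unit disc, so that pointwise convergence is enough.
\<close>

lemma expectation_periodogram_laplace_tendsto:
  fixes X :: "nat \<Rightarrow> 'a \<Rightarrow> real"
  assumes indep: "indep_vars (\<lambda>_. borel) X {1..}"
    and m1: "\<And>j. j \<ge> 1 \<Longrightarrow> expectation (X j) = 0"
    and m2: "\<And>j. j \<ge> 1 \<Longrightarrow> expectation (\<lambda>\<omega>. (X j \<omega>)\<^sup>2) = 1"
    and int3: "\<And>j. j \<ge> 1 \<Longrightarrow> integrable M (\<lambda>\<omega>. \<bar>X j \<omega>\<bar> ^ 3)"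
    and m3: "\<And>j. j \<ge> 1 \<Longrightarrow> expectation (\<lambda>\<omega>. \<bar>X j \<omega>\<bar> ^ 3) \<le> C"
    and m: "m \<ge> 0"
  shows "(\<lambda>n. expectation (\<lambda>\<omega>. periodogram_laplace m (\<lambda>j. X j \<omega>) n)) \<longlonglongrightarrow> 1 / (m + 1)"
proof -
  interpret NN: prob_space normal_pair by (rule prob_space_normal_pair)
  have X: "X j \<in> borel_measurable M" if "j \<in> {1..}" for j
    using indep that by (auto simp: indep_vars_def)
  have "0 \<le> expectation (\<lambda>\<omega>. \<bar>X 1 \<omega>\<bar> ^ 3)"
    by (rule Bochner_Integration.integral_nonneg) simp
  also have "\<dots> \<le> C"
    using m3[of 1] by simp
  finally have C: "C \<ge> 0" .
  define Z where "Z n k \<omega> = scaled_dft (\<lambda>j. X j \<omega>) n k" for n k \<omega>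
  have Z_meas [measurable]: "Z n k \<in> borel_measurable M" for n k
    unfolding Z_def using X by (intro scaled_dft_measurable) auto
  have ReIm [measurable]: "(\<lambda>\<omega>. Re (Z n k \<omega>)) \<in> borel_measurable M" "(\<lambda>\<omega>. Im (Z n k \<omega>)) \<in> borel_measurable M" for n k
    by (auto intro: borel_measurable_continuous_on continuous_intros)
  define \<psi> where "\<psi> n k w = (CLINT \<omega>|M. iexp (sqrt (2 * m) * (fst w * Re (Z n k \<omega>) + snd w * Im (Z n k \<omega>))))" for n k w
  define a where "a n w = 1 / of_nat (num_freqs n) * (\<Sum>k=1..num_freqs n. \<psi> n k w)" for n w
  define e where "e w = complex_of_real (exp (- m * ((fst w)\<^sup>2 + (snd w)\<^sup>2) / 2))" for w :: "real \<times> real"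
  have \<psi>_meas [measurable]: "\<psi> n k \<in> borel_measurable normal_pair" for n k
    unfolding \<psi>_def by measurable
  have \<psi>_le: "cmod (\<psi> n k w) \<le> 1" for n k w
  proof -
    have "cmod (\<psi> n k w) \<le> (\<integral>\<omega>. cmod (iexp (sqrt (2 * m) * (fst w * Re (Z n k \<omega>) + snd w * Im (Z n k \<omega>)))) \<partial>M)"
      unfolding \<psi>_def by (rule integral_norm_bound)
    then show ?thesis by (simp add: prob_space)
  qed
  have \<psi>_int: "integrable normal_pair (\<psi> n k)" for n k
    using \<psi>_le by (intro NN.integrable_const_bound[where B = 1]) auto
  have Z_int: "integrable M (\<lambda>\<omega>. gaussian_bump m (Z n k \<omega>))" for n k
    using m by (intro integrable_const_bound[where B = 1]) (auto simp: gaussian_bump_def)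
  have E_eq: "complex_of_real (expectation (\<lambda>\<omega>. periodogram_laplace m (\<lambda>j. X j \<omega>) n)) = (CLINT w|normal_pair. a n w)" for n
  proof -
    have "expectation (\<lambda>\<omega>. periodogram_laplace m (\<lambda>j. X j \<omega>) n) =
        1 / real (num_freqs n) * (\<Sum>k=1..num_freqs n. expectation (\<lambda>\<omega>. gaussian_bump m (Z n k \<omega>)))"
      unfolding periodogram_laplace_def Z_def[symmetric] using Z_int by simp
    then have "complex_of_real (expectation (\<lambda>\<omega>. periodogram_laplace m (\<lambda>j. X j \<omega>) n)) =
        1 / of_nat (num_freqs n) * (\<Sum>k=1..num_freqs n. complex_of_real (expectation (\<lambda>\<omega>. gaussian_bump m (Z n k \<omega>))))"
      by simp
    also have "\<dots> = 1 / of_nat (num_freqs n) * (\<Sum>k=1..num_freqs n. (CLINT w|normal_pair. \<psi> n k w))"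
      unfolding \<psi>_def by (simp only: expectation_gaussian_bump_eq[OF Z_meas m])
    also have "\<dots> = (CLINT w|normal_pair. a n w)"
      unfolding a_def using \<psi>_int by simp
    finally show ?thesis .
  qed
  have lim: "(\<lambda>n. a n w) \<longlonglongrightarrow> e w" for w
  proof -
    define K where "K = (C + 2) / 6 * (sqrt (2 * m) * (\<bar>fst w\<bar> + \<bar>snd w\<bar>)) ^ 3"
    have K0: "K \<ge> 0" using C m by (simp add: K_def)
    have "\<forall>\<^sub>F n in sequentially. norm (a n w - e w) \<le> K / sqrt (real n)"
      using eventually_ge_at_top[of "3::nat"]
    proof eventually_elim
      case (elim n)
      have r: "num_freqs n > 0" using num_freqs_bounds[OF elim] by simp
      have "a n w - e w = 1 / of_nat (num_freqs n) * (\<Sum>k=1..num_freqs n. \<psi> n k w - e w)"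
        using r by (simp add: a_def sum_subtractf diff_divide_distrib)
      also have "cmod \<dots> \<le> K / sqrt (real n)"
      proof (rule norm_average_le)
        fix k assume "k \<in> {1..num_freqs n}"
        from scaled_dft_projection_gaussian[OF indep m1 m2 int3 m3 m C elim this, of "fst w" "snd w"]
        show "cmod (\<psi> n k w - e w) \<le> K / sqrt (real n)"
          by (simp only: \<psi>_def Z_def e_def K_def)
      qed (use K0 in simp)
      finally show ?case .
    qed
    moreover have "(\<lambda>n. K / sqrt (real n)) \<longlonglongrightarrow> 0"
      by real_asymp
    ultimately have "(\<lambda>n. a n w - e w) \<longlonglongrightarrow> 0"
      by (rule Lim_null_comparison)
    then show ?thesis by (simp add: LIM_zero_iff)
  qed
  have "(\<lambda>n. CLINT w|normal_pair. a n w) \<longlonglongrightarrow> (CLINT w|normal_pair. e w)"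
  proof (rule integral_dominated_convergence[where w = "\<lambda>_. 1"])
    show "e \<in> borel_measurable normal_pair" "a n \<in> borel_measurable normal_pair" for n
      unfolding e_def a_def by measurable
    show "AE w in normal_pair. norm (a n w) \<le> 1" for n
      unfolding a_def using \<psi>_le by (intro AE_I2 norm_average_le) auto
  qed (use lim in auto)
  also have "(CLINT w|normal_pair. e w) = complex_of_real (1 / (m + 1))"
    unfolding e_def integral_complex_of_real gaussian_pair_laplace[OF m] ..
  finally show ?thesis
    unfolding E_eq[symmetric] by (simp only: tendsto_of_real_iff)
qed

end

section \<open>Fourth moments from resampling one coordinate\<close>

lemma (in finite_measure) integrable_bounded:
  fixes f :: "'a \<Rightarrow> real"
  assumes "f \<in> borel_measurable M" "\<And>x. x \<in> space M \<Longrightarrow> \<bar>f x\<bar> \<le> B"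
  shows "integrable M f"
  using assms by (intro integrable_const_bound[where B = B]) auto

lemma abs_square_le:
  fixes u B :: real
  assumes "\<bar>u\<bar> \<le> B"
  shows "\<bar>u\<^sup>2\<bar> \<le> B\<^sup>2"
  using power_mono[OF assms abs_ge_zero, of 2] by simp

lemma (in finite_measure) integrable_bounded_square:
  fixes f :: "'a \<Rightarrow> real"
  assumes [measurable]: "f \<in> borel_measurable M" and "\<And>x. x \<in> space M \<Longrightarrow> \<bar>f x\<bar> \<le> B"
  shows "integrable M (\<lambda>x. (f x)\<^sup>2)"
  using assms by (intro integrable_bounded[where B = "B\<^sup>2"] abs_square_le) auto

lemma (in prob_space) abs_expectation_le:
  fixes f :: "'a \<Rightarrow> real"
  assumes "f \<in> borel_measurable M" "\<And>x. x \<in> space M \<Longrightarrow> \<bar>f x\<bar> \<le> B"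
  shows "\<bar>expectation f\<bar> \<le> B"
proof -
  have int: "integrable M f"
    by (rule integrable_bounded[OF assms])
  have "\<bar>expectation f\<bar> \<le> expectation (\<lambda>x. \<bar>f x\<bar>)"
    by (rule integral_abs_bound)
  also have "\<dots> \<le> B"
    using int assms by (intro integral_le_const) auto
  finally show ?thesis .
qed

lemma (in prob_space) square_expectation_le:
  fixes f :: "'a \<Rightarrow> real"
  assumes [simp]: "integrable M f" "integrable M (\<lambda>x. (f x)\<^sup>2)"
  shows "(expectation f)\<^sup>2 \<le> expectation (\<lambda>x. (f x)\<^sup>2)"
proof -
  have "0 \<le> variance f" by simp
  then show ?thesis by (simp add: variance_eq)
qed

lemma (in prob_space) variance_eq_two_copies:
  fixes f :: "'a \<Rightarrow> real"
  assumes [simp]: "integrable M f" "integrable M (\<lambda>x. (f x)\<^sup>2)"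
  shows "expectation (\<lambda>x. (f x)\<^sup>2) - (expectation f)\<^sup>2 =
           1/2 * expectation (\<lambda>x. expectation (\<lambda>y. (f x - f y)\<^sup>2))"
proof -
  have "expectation (\<lambda>y. (f x - f y)\<^sup>2) = (f x)\<^sup>2 + expectation (\<lambda>x. (f x)\<^sup>2) - 2 * f x * expectation f" for x
    by (simp add: power2_diff prob_space)
  then have "expectation (\<lambda>x. expectation (\<lambda>y. (f x - f y)\<^sup>2)) =
      2 * expectation (\<lambda>x. (f x)\<^sup>2) - 2 * expectation f * expectation f"
    by (simp add: prob_space)
  then show ?thesis
    by (simp add: power2_eq_square)
qed

lemma abs_square_diff_le:
  fixes u v B :: real
  assumes "\<bar>u\<bar> \<le> B" "\<bar>v\<bar> \<le> B"
  shows "\<bar>(u - v)\<^sup>2\<bar> \<le> (2 * B)\<^sup>2"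
  using assms by (intro abs_square_le) linarith

lemma space_PiM_fun_upd:
  assumes "x \<in> space (PiM I M)" "t \<in> space (M j)"
  shows "x(j := t) \<in> space (PiM (insert j I) M)"
  using assms by (auto simp: space_PiM PiE_def extensional_def)

lemma resample_measurable:
  fixes f :: "('i \<Rightarrow> 'a) \<Rightarrow> real"
  assumes [measurable]: "f \<in> borel_measurable (PiM I M)" and j: "j \<in> I"
  shows "(\<lambda>z. (f (fst z) - f ((fst z)(j := snd z)))\<^sup>2) \<in> borel_measurable (PiM I M \<Otimes>\<^sub>M M j)"
proof -
  have [measurable]: "(\<lambda>z. (fst z)(j := snd z)) \<in> PiM I M \<Otimes>\<^sub>M M j \<rightarrow>\<^sub>M PiM I M"
    using j by (intro measurable_fun_upd[where J = I]) auto
  show ?thesis by measurable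
qed

lemma resample_integrable:
  fixes f :: "('i \<Rightarrow> 'a) \<Rightarrow> real"
  assumes prob: "\<And>i. prob_space (M i)"
    and meas: "f \<in> borel_measurable (PiM I M)" and j: "j \<in> I"
    and bd: "\<And>x. x \<in> space (PiM I M) \<Longrightarrow> \<bar>f x\<bar> \<le> B"
  shows "integrable (PiM I M) (\<lambda>x. \<integral>t. (f x - f (x(j := t)))\<^sup>2 \<partial>M j)"
proof -
  interpret P: prob_space "PiM I M" by (rule prob_space_PiM) (rule prob)
  interpret M: prob_space "M i" for i by (rule prob)
  note m = resample_measurable[OF meas j]
  show ?thesis
  proof (rule P.integrable_bounded[where B = "(2 * B)\<^sup>2"])
    show "(\<lambda>x. \<integral>t. (f x - f (x(j := t)))\<^sup>2 \<partial>M j) \<in> borel_measurable (PiM I M)"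
      using m by (intro M.borel_measurable_lebesgue_integral) (simp add: case_prod_beta')
    show "\<bar>\<integral>t. (f x - f (x(j := t)))\<^sup>2 \<partial>M j\<bar> \<le> (2 * B)\<^sup>2" if x: "x \<in> space (PiM I M)" for x
      using measurable_Pair2[OF m x] x j space_PiM_fun_upd[of x I M _ j]
      by (intro M.abs_expectation_le abs_square_diff_le bd) (auto simp: insert_absorb)
  qed
qed

text \<open>
  Each summand on the right, with its factor \<open>1/2\<close>, is the expected variance in one coordinate,
  written with an independent copy.  In the induction, averaging over the new coordinate \<open>i\<close>
  splits the variance into the expected variance in coordinate \<open>i\<close> and the variance of the average
  \<open>g\<close>; averaging over \<open>i\<close> does not increase the squared effect of resampling another coordinate,
  because a square of a mean is at most the mean of the squares.
\<close>

lemma efron_stein: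
  fixes f :: "('i \<Rightarrow> 'a) \<Rightarrow> real"
  assumes prob: "\<And>i. prob_space (M i)"
    and "finite I" "f \<in> borel_measurable (PiM I M)"
    and "\<And>x. x \<in> space (PiM I M) \<Longrightarrow> \<bar>f x\<bar> \<le> B"
  shows "(\<integral>x. (f x)\<^sup>2 \<partial>PiM I M) - (\<integral>x. f x \<partial>PiM I M)\<^sup>2
       \<le> 1/2 * (\<Sum>i\<in>I. \<integral>x. (\<integral>t. (f x - f (x(i := t)))\<^sup>2 \<partial>M i) \<partial>PiM I M)"
  using assms(2-)
proof (induction I arbitrary: f rule: finite_induct)
  case empty
  then show ?case
    by (simp add: PiM_empty lebesgue_integral_count_space_finite)
next
  case (insert i I)
  note [measurable] = insert.prems(1)
  let ?P = "PiM I M" and ?P' = "PiM (insert i I) M"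
  have updi [measurable]: "(\<lambda>z. (fst z)(i := snd z)) \<in> ?P \<Otimes>\<^sub>M M i \<rightarrow>\<^sub>M ?P'"
    by (rule measurable_fun_upd[where J = I]) auto
  interpret P: prob_space ?P by (rule prob_space_PiM) (rule prob)
  interpret P': prob_space ?P' by (rule prob_space_PiM) (rule prob)
  interpret M: prob_space "M k" for k by (rule prob)
  interpret product_sigma_finite M by standard
  define h where "h x t = f (x(i := t))" for x t
  define g where "g x = (\<integral>t. h x t \<partial>M i)" for x
  have h_meas [measurable]: "(\<lambda>z. h (fst z) (snd z)) \<in> borel_measurable (?P \<Otimes>\<^sub>M M i)"
    unfolding h_def by measurable
  have hx_meas: "h x \<in> borel_measurable (M i)" if "x \<in> space ?P" for x
    using measurable_Pair2[OF h_meas that] by simp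
  have h_bd: "\<bar>h x t\<bar> \<le> B" if "x \<in> space ?P" "t \<in> space (M i)" for x t
    unfolding h_def by (rule insert.prems(2)[OF space_PiM_fun_upd[OF that]])
  have h_int: "integrable (M i) (h x)" "integrable (M i) (\<lambda>t. (h x t)\<^sup>2)" if "x \<in> space ?P" for x
    using hx_meas[OF that] h_bd[OF that] by (auto intro: M.integrable_bounded M.integrable_bounded_square)
  have g_meas [measurable]: "g \<in> borel_measurable ?P"
    unfolding g_def using h_meas
    by (intro M.borel_measurable_lebesgue_integral) (simp add: case_prod_beta')
  have g_bd: "\<bar>g x\<bar> \<le> B" if "x \<in> space ?P" for x
    unfolding g_def using that h_bd hx_meas by (intro M.abs_expectation_le) auto
  note f_int = P'.integrable_bounded[OF insert.prems] P'.integrable_bounded_square[OF insert.prems]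
  note g_int = P.integrable_bounded[OF g_meas g_bd] P.integrable_bounded_square[OF g_meas g_bd]
  have Ef: "(\<integral>x. f x \<partial>?P') = (\<integral>x. g x \<partial>?P)"
    unfolding g_def h_def using insert.hyps f_int by (intro product_integral_insert)
  have Ef2: "(\<integral>x. (f x)\<^sup>2 \<partial>?P') = (\<integral>x. (\<integral>t. (h x t)\<^sup>2 \<partial>M i) \<partial>?P)"
    unfolding h_def using insert.hyps f_int by (intro product_integral_insert)
  have h2_meas: "(\<lambda>x. \<integral>t. (h x t)\<^sup>2 \<partial>M i) \<in> borel_measurable ?P"
    using h_meas by (intro M.borel_measurable_lebesgue_integral) (simp add: case_prod_beta')
  have h2_int: "integrable ?P (\<lambda>x. \<integral>t. (h x t)\<^sup>2 \<partial>M i)"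
  proof (rule P.integrable_bounded[OF h2_meas], rule M.abs_expectation_le)
    show "(\<lambda>t. (h x t)\<^sup>2) \<in> borel_measurable (M i)" if "x \<in> space ?P" for x
      using hx_meas[OF that] by measurable
    show "\<bar>(h x t)\<^sup>2\<bar> \<le> B\<^sup>2" if "x \<in> space ?P" "t \<in> space (M i)" for x t
      by (rule abs_square_le[OF h_bd[OF that]])
  qed
  have term_eq: "(\<integral>x. (\<integral>t. (f x - f (x(j := t)))\<^sup>2 \<partial>M j) \<partial>?P') =
      (\<integral>x. (\<integral>t. (\<integral>s. (f (x(i := t)) - f (x(i := t, j := s)))\<^sup>2 \<partial>M j) \<partial>M i) \<partial>?P)" if "j \<in> insert i I" for j
    using insert.hyps resample_integrable[OF prob insert.prems(1) that insert.prems(2)]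
    by (intro product_integral_insert)
  have main: "(\<integral>x. (\<integral>s. (g x - g (x(j := s)))\<^sup>2 \<partial>M j) \<partial>?P) \<le> (\<integral>x. (\<integral>t. (f x - f (x(j := t)))\<^sup>2 \<partial>M j) \<partial>?P')"
    if j: "j \<in> I" for j
  proof -
    have ji: "j \<noteq> i" using j insert.hyps by auto
    \<comment> \<open>The squared effect of resampling \<open>j\<close> when coordinate \<open>i\<close> has the value \<open>t\<close>.\<close>
    define K where "K x t s = (h x t - h (x(j := s)) t)\<^sup>2" for x t s
    have K_eq: "K x t s = (f (x(i := t)) - f (x(i := t, j := s)))\<^sup>2" for x t s
      using ji by (simp add: K_def h_def fun_upd_twist)
    have K_bd: "\<bar>K x t s\<bar> \<le> (2 * B)\<^sup>2" if "x \<in> space ?P" "t \<in> space (M i)" "s \<in> space (M j)" for x t s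
      unfolding K_def using that j space_PiM_fun_upd[of x I M s j]
      by (intro abs_square_diff_le h_bd) (auto simp: insert_absorb)
    have K_meas: "(\<lambda>z. K (fst (fst z)) (snd (fst z)) (snd z)) \<in> borel_measurable ((?P \<Otimes>\<^sub>M M i) \<Otimes>\<^sub>M M j)"
    proof -
      have "(\<lambda>z. ((fst (fst z))(i := snd (fst z)), snd z)) \<in> (?P \<Otimes>\<^sub>M M i) \<Otimes>\<^sub>M M j \<rightarrow>\<^sub>M ?P' \<Otimes>\<^sub>M M j"
        by (intro measurable_Pair measurable_compose[OF measurable_fst updi] measurable_snd)
      from measurable_compose[OF this resample_measurable[OF insert.prems(1) insertI2[OF j]]]
      show ?thesis by (simp only: K_eq fst_conv snd_conv)
    qed
    have K_meas2: "(\<lambda>z. \<integral>s. K (fst z) (snd z) s \<partial>M j) \<in> borel_measurable (?P \<Otimes>\<^sub>M M i)"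
      using K_meas by (intro M.borel_measurable_lebesgue_integral) (simp add: case_prod_beta')
    have K_meas1: "(\<lambda>x. \<integral>t. (\<integral>s. K x t s \<partial>M j) \<partial>M i) \<in> borel_measurable ?P"
      using K_meas2 by (intro M.borel_measurable_lebesgue_integral) (simp add: case_prod_beta')
    have Kxt_meas: "K x t \<in> borel_measurable (M j)" if "x \<in> space ?P" "t \<in> space (M i)" for x t
      using measurable_Pair2[OF K_meas, of "(x, t)"] that by (simp add: space_pair_measure)
    have Kx_meas: "(\<lambda>t. \<integral>s. K x t s \<partial>M j) \<in> borel_measurable (M i)" if "x \<in> space ?P" for x
      using measurable_Pair2[OF K_meas2 that] by simp
    have bd1: "\<bar>\<integral>s. K x t s \<partial>M j\<bar> \<le> (2 * B)\<^sup>2" if "x \<in> space ?P" "t \<in> space (M i)" for x t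
      by (rule M.abs_expectation_le[OF Kxt_meas[OF that] K_bd[OF that]])
    have bd2: "\<bar>\<integral>t. (\<integral>s. K x t s \<partial>M j) \<partial>M i\<bar> \<le> (2 * B)\<^sup>2" if "x \<in> space ?P" for x
      by (rule M.abs_expectation_le[OF Kx_meas[OF that] bd1[OF that]])
    have "(\<integral>x. (\<integral>s. (g x - g (x(j := s)))\<^sup>2 \<partial>M j) \<partial>?P)
       \<le> (\<integral>x. (\<integral>t. (\<integral>s. K x t s \<partial>M j) \<partial>M i) \<partial>?P)"
    proof (rule integral_mono)
      show "integrable ?P (\<lambda>x. \<integral>s. (g x - g (x(j := s)))\<^sup>2 \<partial>M j)"
        by (rule resample_integrable[OF prob g_meas j g_bd])
      show "integrable ?P (\<lambda>x. \<integral>t. (\<integral>s. K x t s \<partial>M j) \<partial>M i)"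
        by (rule P.integrable_bounded[OF K_meas1 bd2])
      fix x assume x: "x \<in> space ?P"
      interpret ij: pair_prob_space "M i" "M j" ..
      have Kx: "(\<lambda>z. K x (fst z) (snd z)) \<in> borel_measurable (M i \<Otimes>\<^sub>M M j)"
      proof -
        have "(\<lambda>z. ((x, fst z), snd z)) \<in> M i \<Otimes>\<^sub>M M j \<rightarrow>\<^sub>M (?P \<Otimes>\<^sub>M M i) \<Otimes>\<^sub>M M j"
          using x by (intro measurable_Pair measurable_const measurable_fst measurable_snd)
        from measurable_compose[OF this K_meas] show ?thesis by simp
      qed
      have Kx_int: "integrable (M i \<Otimes>\<^sub>M M j) (\<lambda>(t, s). K x t s)"
        using Kx K_bd[OF x]
        by (intro ij.integrable_bounded[where B = "(2 * B)\<^sup>2"])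
          (auto simp: space_pair_measure case_prod_beta')
      \<comment> \<open>Jensen's inequality for the average over coordinate \<open>i\<close>, then Fubini.\<close>
      have "(\<integral>s. (g x - g (x(j := s)))\<^sup>2 \<partial>M j) \<le> (\<integral>s. (\<integral>t. K x t s \<partial>M i) \<partial>M j)"
      proof (rule integral_mono)
        show "integrable (M j) (\<lambda>s. (g x - g (x(j := s)))\<^sup>2)"
          using measurable_Pair2[OF resample_measurable[OF g_meas j] x] x j space_PiM_fun_upd[of x I M _ j]
          by (intro M.integrable_bounded[where B = "(2 * B)\<^sup>2"] abs_square_diff_le g_bd)
            (auto simp: insert_absorb)
        show "integrable (M j) (\<lambda>s. \<integral>t. K x t s \<partial>M i)"
          using ij.integrable_snd[OF Kx_int] .
        fix s assume s: "s \<in> space (M j)"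
        have xs: "x(j := s) \<in> space ?P"
          using x s j space_PiM_fun_upd[of x I M s j] by (auto simp: insert_absorb)
        have "g x - g (x(j := s)) = (\<integral>t. h x t - h (x(j := s)) t \<partial>M i)"
          unfolding g_def using h_int(1)[OF x] h_int(1)[OF xs] by simp
        moreover have "(\<integral>t. h x t - h (x(j := s)) t \<partial>M i)\<^sup>2 \<le> (\<integral>t. (h x t - h (x(j := s)) t)\<^sup>2 \<partial>M i)"
        proof (rule M.square_expectation_le)
          show "integrable (M i) (\<lambda>t. h x t - h (x(j := s)) t)"
            using h_int(1)[OF x] h_int(1)[OF xs] by simp
          show "integrable (M i) (\<lambda>t. (h x t - h (x(j := s)) t)\<^sup>2)"
            using hx_meas[OF x] hx_meas[OF xs] h_bd[OF x] h_bd[OF xs]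
            by (intro M.integrable_bounded[where B = "(2 * B)\<^sup>2"] abs_square_diff_le) auto
        qed
        ultimately show "(g x - g (x(j := s)))\<^sup>2 \<le> (\<integral>t. K x t s \<partial>M i)"
          by (simp add: K_def)
      qed
      also have "\<dots> = (\<integral>t. (\<integral>s. K x t s \<partial>M j) \<partial>M i)"
        using ij.Fubini_integral[OF Kx_int] .
      finally show "(\<integral>s. (g x - g (x(j := s)))\<^sup>2 \<partial>M j) \<le> (\<integral>t. (\<integral>s. K x t s \<partial>M j) \<partial>M i)" .
    qed
    also have "\<dots> = (\<integral>x. (\<integral>t. (f x - f (x(j := t)))\<^sup>2 \<partial>M j) \<partial>?P')"
      unfolding term_eq[OF insertI2[OF j]] K_eq ..
    finally show ?thesis .
  qed
  have "(\<integral>x. (f x)\<^sup>2 \<partial>?P') - (\<integral>x. f x \<partial>?P')\<^sup>2 =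
      (\<integral>x. (\<integral>t. (h x t)\<^sup>2 \<partial>M i) - (g x)\<^sup>2 \<partial>?P) + ((\<integral>x. (g x)\<^sup>2 \<partial>?P) - (\<integral>x. g x \<partial>?P)\<^sup>2)"
    using h2_int g_int by (simp add: Ef Ef2)
  moreover have "(\<integral>x. (\<integral>t. (h x t)\<^sup>2 \<partial>M i) - (g x)\<^sup>2 \<partial>?P) =
      1/2 * (\<integral>x. (\<integral>t. (f x - f (x(i := t)))\<^sup>2 \<partial>M i) \<partial>?P')"
  proof -
    have "(\<integral>x. (\<integral>t. (h x t)\<^sup>2 \<partial>M i) - (g x)\<^sup>2 \<partial>?P) =
        (\<integral>x. 1/2 * (\<integral>t. (\<integral>s. (h x t - h x s)\<^sup>2 \<partial>M i) \<partial>M i) \<partial>?P)"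
      unfolding g_def by (intro Bochner_Integration.integral_cong refl M.variance_eq_two_copies h_int)
    then show ?thesis
      unfolding term_eq[OF insertI1] h_def by simp
  qed
  moreover have "(\<integral>x. (g x)\<^sup>2 \<partial>?P) - (\<integral>x. g x \<partial>?P)\<^sup>2 \<le>
      1/2 * (\<Sum>j\<in>I. \<integral>x. (\<integral>t. (f x - f (x(j := t)))\<^sup>2 \<partial>M j) \<partial>?P')"
  proof -
    have "(\<integral>x. (g x)\<^sup>2 \<partial>?P) - (\<integral>x. g x \<partial>?P)\<^sup>2 \<le>
        1/2 * (\<Sum>j\<in>I. \<integral>x. (\<integral>t. (g x - g (x(j := t)))\<^sup>2 \<partial>M j) \<partial>?P)"
      by (rule insert.IH) (use g_bd in auto)
    also have "\<dots> \<le> 1/2 * (\<Sum>j\<in>I. \<integral>x. (\<integral>t. (f x - f (x(j := t)))\<^sup>2 \<partial>M j) \<partial>?P')"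
      using main by (intro mult_left_mono sum_mono) auto
    finally show ?thesis .
  qed
  ultimately show ?case
    unfolding sum.insert[OF insert.hyps] distrib_left by linarith
qed

text \<open>
  The form in which the inequality is used: a pointwise bound \<open>b i x\<close> on the effect of
  resampling, summed over the sites before it is integrated.
\<close>

lemma efron_stein_sitewise:
  fixes f :: "('i \<Rightarrow> 'a) \<Rightarrow> real"
  assumes prob: "\<And>i. prob_space (M i)" and fin: "finite I"
    and [measurable]: "f \<in> borel_measurable (PiM I M)"
    and bd: "\<And>x. x \<in> space (PiM I M) \<Longrightarrow> \<bar>f x\<bar> \<le> B"
    and b: "\<And>i x t. i \<in> I \<Longrightarrow> x \<in> space (PiM I M) \<Longrightarrow> t \<in> space (M i) \<Longrightarrow> (f x - f (x(i := t)))\<^sup>2 \<le> b i x"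
    and s: "\<And>x. x \<in> space (PiM I M) \<Longrightarrow> (\<Sum>i\<in>I. b i x) \<le> s x"
    and s_int: "integrable (PiM I M) s"
  shows "(\<integral>x. (f x)\<^sup>2 \<partial>PiM I M) - (\<integral>x. f x \<partial>PiM I M)\<^sup>2 \<le> 1/2 * (\<integral>x. s x \<partial>PiM I M)"
proof -
  interpret M: prob_space "M i" for i by (rule prob)
  note int = resample_integrable[OF prob assms(3) _ bd]
  have "(\<Sum>i\<in>I. \<integral>x. (\<integral>t. (f x - f (x(i := t)))\<^sup>2 \<partial>M i) \<partial>PiM I M) =
      (\<integral>x. (\<Sum>i\<in>I. \<integral>t. (f x - f (x(i := t)))\<^sup>2 \<partial>M i) \<partial>PiM I M)"
    using int by (intro Bochner_Integration.integral_sum[symmetric]) auto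
  also have "\<dots> \<le> (\<integral>x. s x \<partial>PiM I M)"
  proof (rule integral_mono)
    fix x assume x: "x \<in> space (PiM I M)"
    have "(\<integral>t. (f x - f (x(i := t)))\<^sup>2 \<partial>M i) \<le> b i x" if i: "i \<in> I" for i
    proof (rule M.integral_le_const)
      show "integrable (M i) (\<lambda>t. (f x - f (x(i := t)))\<^sup>2)"
        using measurable_Pair2[OF resample_measurable[OF assms(3) i] x] x i space_PiM_fun_upd[of x I M _ i]
        by (intro M.integrable_bounded[where B = "(2 * B)\<^sup>2"] abs_square_diff_le bd)
          (auto simp: insert_absorb)
    qed (use b[OF i x] in auto)
    then show "(\<Sum>i\<in>I. \<integral>t. (f x - f (x(i := t)))\<^sup>2 \<partial>M i) \<le> s x"
      using s[OF x] by (meson order_trans sum_mono)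
  qed (use int s_int in auto)
  finally show ?thesis
    using efron_stein[OF prob fin assms(3) bd] by linarith
qed

text \<open>
  Efron--Stein for the centred function \<open>h\<close> bounds its variance by \<open>K / 2\<close>.  Changing one
  coordinate changes \<open>h\<^sup>2\<close> by \<open>d (2 h - d)\<close>, where \<open>d\<close> is the change of \<open>h\<close>, so a second
  application to \<open>h\<^sup>2\<close> bounds the variance of \<open>h\<^sup>2\<close> by \<open>4 K E(h\<^sup>2) + K\<^sup>2 \<le> 3 K\<^sup>2\<close>.
\<close>

lemma fourth_central_moment_le:
  fixes f :: "('i \<Rightarrow> 'a) \<Rightarrow> real"
  assumes prob: "\<And>i. prob_space (M i)" and fin: "finite I"
    and [measurable]: "f \<in> borel_measurable (PiM I M)"
    and bd: "\<And>x. x \<in> space (PiM I M) \<Longrightarrow> \<bar>f x\<bar> \<le> B"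
    and b: "\<And>i x t. i \<in> I \<Longrightarrow> x \<in> space (PiM I M) \<Longrightarrow> t \<in> space (M i) \<Longrightarrow> (f x - f (x(i := t)))\<^sup>2 \<le> b i x"
    and K: "\<And>x. x \<in> space (PiM I M) \<Longrightarrow> (\<Sum>i\<in>I. b i x) \<le> K"
  shows "(\<integral>x. (f x - (\<integral>y. f y \<partial>PiM I M)) ^ 4 \<partial>PiM I M) \<le> 4 * K\<^sup>2"
proof -
  let ?P = "PiM I M"
  interpret P: prob_space ?P by (rule prob_space_PiM) (rule prob)
  interpret M: prob_space "M i" for i by (rule prob)
  define e where "e = (\<integral>y. f y \<partial>?P)"
  define h where "h x = f x - e" for x
  have [measurable]: "h \<in> borel_measurable ?P" unfolding h_def by measurable
  have e_bd: "\<bar>e\<bar> \<le> B"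
    unfolding e_def using bd by (intro P.abs_expectation_le) auto
  have h_bd: "\<bar>h x\<bar> \<le> 2 * B" if "x \<in> space ?P" for x
    using bd[OF that] e_bd unfolding h_def by linarith
  have h2_bd: "\<bar>(h x)\<^sup>2\<bar> \<le> (2 * B)\<^sup>2" if "x \<in> space ?P" for x
    by (rule abs_square_le[OF h_bd[OF that]])
  have f_int: "integrable ?P f"
    using bd by (rule P.integrable_bounded[OF assms(3)])
  have h_int: "integrable ?P (\<lambda>x. (h x)\<^sup>2)"
    using h2_bd by (intro P.integrable_bounded[where B = "(2 * B)\<^sup>2"]) auto
  have bh: "(h x - h (x(i := t)))\<^sup>2 \<le> b i x" if "i \<in> I" "x \<in> space ?P" "t \<in> space (M i)" for i x t
    using b[OF that] by (simp add: h_def)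
  have b0: "0 \<le> b i x" if "i \<in> I" "x \<in> space ?P" for i x
    using b[OF that] M.not_empty[of i] by (meson all_not_in_conv order_trans zero_le_power2)
  have Eh: "(\<integral>x. h x \<partial>?P) = 0"
    using f_int by (simp add: h_def e_def P.prob_space)
  have var: "(\<integral>x. (h x)\<^sup>2 \<partial>?P) \<le> K / 2"
    using efron_stein_sitewise[where M = M, OF prob fin, where f = h and B = "2 * B" and b = b and s = "\<lambda>_. K"] h_bd bh K
    by (simp add: Eh P.prob_space)
  have var0: "0 \<le> (\<integral>x. (h x)\<^sup>2 \<partial>?P)" by simp
  have K0: "0 \<le> K" using var var0 by linarith
  have "(\<integral>x. ((h x)\<^sup>2)\<^sup>2 \<partial>?P) - (\<integral>x. (h x)\<^sup>2 \<partial>?P)\<^sup>2 \<le> 1/2 * (\<integral>x. 8 * K * (h x)\<^sup>2 + 2 * K\<^sup>2 \<partial>?P)"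
  proof (rule efron_stein_sitewise[OF prob fin])
    show "\<bar>(h x)\<^sup>2\<bar> \<le> (2 * B)\<^sup>2" if "x \<in> space ?P" for x
      by (rule h2_bd[OF that])
    fix i x t assume ixt: "i \<in> I" "x \<in> space ?P" "t \<in> space (M i)"
    define d where "d = h x - h (x(i := t))"
    have d: "d\<^sup>2 \<le> b i x" using bh[OF ixt] by (simp add: d_def)
    have "((h x)\<^sup>2 - (h (x(i := t)))\<^sup>2)\<^sup>2 = d\<^sup>2 * (2 * h x - d)\<^sup>2"
      by (simp add: d_def power2_eq_square algebra_simps)
    also have "\<dots> \<le> d\<^sup>2 * (8 * (h x)\<^sup>2 + 2 * d\<^sup>2)"
    proof (rule mult_left_mono)
      show "(2 * h x - d)\<^sup>2 \<le> 8 * (h x)\<^sup>2 + 2 * d\<^sup>2"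
        using zero_le_power2[of "2 * h x + d"] by (simp add: power2_eq_square algebra_simps)
    qed simp
    also have "\<dots> \<le> b i x * (8 * (h x)\<^sup>2 + 2 * b i x)"
      using d b0[OF ixt(1,2)] by (intro mult_mono add_mono mult_left_mono) auto
    finally show "((h x)\<^sup>2 - (h (x(i := t)))\<^sup>2)\<^sup>2 \<le> b i x * (8 * (h x)\<^sup>2 + 2 * b i x)" .
  next
    fix x assume x: "x \<in> space ?P"
    have "b i x \<le> K" if i: "i \<in> I" for i
      using K[OF x] member_le_sum[of i I "\<lambda>i. b i x"] b0 x i fin by force
    then have "(\<Sum>i\<in>I. b i x * (8 * (h x)\<^sup>2 + 2 * b i x)) \<le> (\<Sum>i\<in>I. b i x * (8 * (h x)\<^sup>2 + 2 * K))"
      using b0 x by (intro sum_mono mult_left_mono) auto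
    also have "\<dots> = (\<Sum>i\<in>I. b i x) * (8 * (h x)\<^sup>2 + 2 * K)"
      by (simp add: sum_distrib_right)
    also have "\<dots> \<le> K * (8 * (h x)\<^sup>2 + 2 * K)"
      using K[OF x] K0 by (intro mult_right_mono) auto
    finally show "(\<Sum>i\<in>I. b i x * (8 * (h x)\<^sup>2 + 2 * b i x)) \<le> 8 * K * (h x)\<^sup>2 + 2 * K\<^sup>2"
      by (simp add: power2_eq_square algebra_simps)
  qed (use h_int in auto)
  also have "\<dots> = 4 * K * (\<integral>x. (h x)\<^sup>2 \<partial>?P) + K\<^sup>2"
    using h_int by (simp add: P.prob_space)
  also have "\<dots> \<le> 4 * K * (K / 2) + K\<^sup>2"
    using var K0 by (intro add_mono mult_left_mono) auto
  finally have "(\<integral>x. ((h x)\<^sup>2)\<^sup>2 \<partial>?P) \<le> (\<integral>x. (h x)\<^sup>2 \<partial>?P)\<^sup>2 + 4 * K * (K / 2) + K\<^sup>2"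
    by linarith
  also have "\<dots> \<le> (K / 2)\<^sup>2 + 4 * K * (K / 2) + K\<^sup>2"
    using power_mono[OF var var0, of 2] by simp
  also have "\<dots> \<le> 4 * K\<^sup>2"
    by (simp add: power2_eq_square)
  finally show ?thesis
    by (simp add: h_def e_def power2_eq_square power4_eq_xxxx mult.assoc)
qed

text \<open>
  The joint law of independent variables is a product measure.
\<close>

lemma (in prob_space) fourth_central_moment_indep_le:
  fixes X :: "'i \<Rightarrow> 'a \<Rightarrow> real" and f :: "('i \<Rightarrow> real) \<Rightarrow> real"
  assumes indep: "indep_vars (\<lambda>_. borel) X I" and fin: "finite I" "I \<noteq> {}"
    and f: "f \<in> borel_measurable (PiM I (\<lambda>_. borel))"
    and bd: "\<And>x. \<bar>f x\<bar> \<le> B"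
    and b: "\<And>i x t. i \<in> I \<Longrightarrow> (f x - f (x(i := t)))\<^sup>2 \<le> b i x"
    and K: "\<And>x. (\<Sum>i\<in>I. b i x) \<le> K"
  shows "expectation (\<lambda>\<omega>. (f (\<lambda>i\<in>I. X i \<omega>) - expectation (\<lambda>\<omega>. f (\<lambda>i\<in>I. X i \<omega>))) ^ 4) \<le> 4 * K\<^sup>2"
proof -
  \<comment> \<open>The product measure needs a law at every index, also outside \<open>I\<close>.\<close>
  define X' where "X' i = (if i \<in> I then X i else (\<lambda>_. 0))" for i
  define N where "N i = distr M borel (X' i)" for i
  have X: "X i \<in> borel_measurable M" if "i \<in> I" for i
    using indep that by (auto simp: indep_vars_def)
  have X': "X' i \<in> borel_measurable M" for i
    using X by (simp add: X'_def)
  have prob: "prob_space (N i)" for i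
    unfolding N_def using X' by (rule prob_space_distr)
  have Xr: "(\<lambda>\<omega>. \<lambda>i\<in>I. X i \<omega>) \<in> M \<rightarrow>\<^sub>M PiM I (\<lambda>_. borel)"
    using X by (intro measurable_restrict) auto
  have "distr M (PiM I (\<lambda>_. borel)) (\<lambda>\<omega>. \<lambda>i\<in>I. X i \<omega>) = PiM I (\<lambda>i. distr M borel (X i))"
    using indep_vars_iff_distr_eq_PiM'[OF fin(2), where M' = "\<lambda>_. borel" and X = X] X indep by auto
  also have "\<dots> = PiM I N"
    by (intro PiM_cong) (auto simp: N_def X'_def)
  finally have distr: "distr M (PiM I (\<lambda>_. borel)) (\<lambda>\<omega>. \<lambda>i\<in>I. X i \<omega>) = PiM I N" .
  have sets: "sets (PiM I N) = sets (PiM I (\<lambda>_. borel))"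
    by (intro sets_PiM_cong) (auto simp: N_def)
  have fN: "f \<in> borel_measurable (PiM I N)"
    using f by (simp add: measurable_cong_sets[OF sets])
  have eq: "expectation (\<lambda>\<omega>. h (\<lambda>i\<in>I. X i \<omega>)) = (\<integral>x. h x \<partial>PiM I N)"
    if "h \<in> borel_measurable (PiM I (\<lambda>_. borel))" for h :: "('i \<Rightarrow> real) \<Rightarrow> real"
    unfolding distr[symmetric] using Xr that by (subst integral_distr) auto
  have "(\<integral>x. (f x - (\<integral>y. f y \<partial>PiM I N)) ^ 4 \<partial>PiM I N) \<le> 4 * K\<^sup>2"
    by (rule fourth_central_moment_le[where M = N, OF prob fin(1) fN bd b K])
  then show ?thesis
    using f by (subst eq, measurable, subst eq) auto
qed

section \<open>Almost sure convergence\<close>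

text \<open>
  The sum of the functions has a finite integral, hence is finite almost everywhere, and the
  terms of a convergent series tend to 0.
\<close>

lemma AE_tendsto_0_of_summable_integrals:
  fixes f :: "nat \<Rightarrow> 'a \<Rightarrow> real"
  assumes int: "\<And>n. integrable M (f n)" and nonneg: "\<And>n x. 0 \<le> f n x"
    and sum: "summable (\<lambda>n. \<integral>x. f n x \<partial>M)"
  shows "AE x in M. (\<lambda>n. f n x) \<longlonglongrightarrow> 0"
proof -
  have [measurable]: "f n \<in> borel_measurable M" for n
    using int by auto
  have "(\<integral>\<^sup>+x. (\<Sum>n. ennreal (f n x)) \<partial>M) = (\<Sum>n. \<integral>\<^sup>+x. ennreal (f n x) \<partial>M)"
    by (rule nn_integral_suminf) measurable
  also have "\<dots> = (\<Sum>n. ennreal (\<integral>x. f n x \<partial>M))"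
    using nonneg by (simp add: nn_integral_eq_integral[OF int])
  also have "\<dots> = ennreal (\<Sum>n. \<integral>x. f n x \<partial>M)"
    using nonneg sum by (intro suminf_ennreal2) auto
  also have "\<dots> \<noteq> \<infinity>" by simp
  finally have "AE x in M. (\<Sum>n. ennreal (f n x)) \<noteq> \<infinity>"
    by (intro nn_integral_PInf_AE) auto
  then show ?thesis
  proof eventually_elim
    case (elim x)
    then have "summable (\<lambda>n. f n x)"
      using nonneg by (intro summable_suminf_not_top) auto
    then show ?case by (rule summable_LIMSEQ_zero)
  qed
qed

definition clip :: "real \<Rightarrow> real \<Rightarrow> real" where
  "clip a t = max (- a) (min a t)"

lemma clip_measurable [measurable]: "clip a \<in> borel_measurable borel"
  unfolding clip_def by measurable

lemma clip_diff_square_le: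
  assumes "a \<ge> 0"
  shows "(clip a s - clip a t)\<^sup>2 \<le> 4 * a\<^sup>2"
proof -
  have "\<bar>clip a s - clip a t\<bar> \<le> 2 * a"
    using assms unfolding clip_def by linarith
  from abs_square_le[OF this] show ?thesis by (simp add: power_mult_distrib)
qed

lemma clip_error_antimono:
  assumes "0 \<le> a" "a \<le> b"
  shows "(t - clip b t)\<^sup>2 \<le> (t - clip a t)\<^sup>2"
proof -
  have "\<bar>t - clip b t\<bar> \<le> \<bar>t - clip a t\<bar>"
    using assms unfolding clip_def by linarith
  then show ?thesis by (simp add: abs_le_square_iff)
qed

lemma clip_error_le:
  assumes a: "a > 0"
  shows "(t - clip a t)\<^sup>2 \<le> \<bar>t\<bar> ^ 3 / a"
proof (cases "\<bar>t\<bar> \<le> a")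
  case True
  then have "t - clip a t = 0" unfolding clip_def by linarith
  with a show ?thesis by simp
next
  case False
  have "\<bar>t - clip a t\<bar> \<le> \<bar>t\<bar>"
    using a unfolding clip_def by linarith
  then have "(t - clip a t)\<^sup>2 \<le> \<bar>t\<bar>\<^sup>2 * 1"
    by (simp add: abs_le_square_iff)
  also have "\<dots> \<le> \<bar>t\<bar>\<^sup>2 * (\<bar>t\<bar> / a)"
    using False a by (intro mult_left_mono) auto
  also have "\<dots> = \<bar>t\<bar> ^ 3 / a"
    by (simp only: power3_eq_cube power2_eq_square times_divide_eq_right mult.assoc)
  finally show ?thesis .
qed

text \<open>
  Any exponent strictly between 0 and \<open>1 / 8\<close> would do: the fourth moment bound is of order
  \<open>clip_level n ^ 8 / n\<^sup>2\<close>, which has to be summable, while the clipping error is of order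
  \<open>1 / clip_level n\<close>, which has to be summable along powers of 2.
\<close>

definition clip_level :: "nat \<Rightarrow> real" where
  "clip_level n = real n powr (1 / 16)"

context prob_space
begin

text \<open>
  Clipped observations differ by at most \<open>2 a\<close>, so the site bounds apply with \<open>D = 4 a\<^sup>2\<close>.
\<close>

lemma clipped_laplace_fourth_moment:
  fixes X :: "nat \<Rightarrow> 'a \<Rightarrow> real"
  assumes indep: "indep_vars (\<lambda>_. borel) X {1..}"
    and m: "m \<ge> 0" and a: "a \<ge> 1" and n: "n \<ge> 3"
  defines "V \<equiv> (\<lambda>\<omega>. periodogram_laplace m (\<lambda>j. clip a (X j \<omega>)) n)"
  shows "expectation (\<lambda>\<omega>. (V \<omega> - expectation V) ^ 4) \<le> 4 * ((32 * m + 1152 * m\<^sup>2) * a ^ 4 / real n)\<^sup>2"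
proof -
  define f where "f x = periodogram_laplace m (\<lambda>j. clip a (x j)) n" for x
  define D where "D = 4 * a\<^sup>2"
  define K where "K = (2 * D * m + 18 * m\<^sup>2 * D\<^sup>2) / real (num_freqs n)"
  have a0: "a \<ge> 0" using a by simp
  have D0: "D \<ge> 0" by (simp add: D_def)
  note r = num_freqs_bounds[OF n]
  have "expectation (\<lambda>\<omega>. (f (\<lambda>j\<in>{1..n}. X j \<omega>) - expectation (\<lambda>\<omega>. f (\<lambda>j\<in>{1..n}. X j \<omega>))) ^ 4) \<le> 4 * K\<^sup>2"
  proof (rule fourth_central_moment_indep_le)
    show "indep_vars (\<lambda>_. borel) X {1..n}"
      by (rule indep_vars_subset[OF indep]) auto
    show "f \<in> borel_measurable (PiM {1..n} (\<lambda>_. borel))"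
      unfolding f_def by (rule periodogram_laplace_measurable) measurable
    show "\<bar>f x\<bar> \<le> 1" for x
      unfolding f_def by (rule periodogram_laplace_bounds[OF m])
    show "(f x - f (x(j := t)))\<^sup>2 \<le> site_bound m n D j (\<lambda>i. clip a (x i))" if "j \<in> {1..n}" for j x t
    proof -
      have "(\<lambda>i. clip a ((x(j := t)) i)) = (\<lambda>i. clip a (x i))(j := clip a t)"
        by auto
      then show ?thesis
        unfolding f_def D_def
        by (simp only:) (rule periodogram_laplace_site_change[OF m n that clip_diff_square_le[OF a0]])
    qed
    show "(\<Sum>j=1..n. site_bound m n D j (\<lambda>i. clip a (x i))) \<le> K" for x
      unfolding K_def by (rule sum_site_bound_le[OF m n D0])
  qed (use n in auto)
  moreover have "f (\<lambda>j\<in>{1..n}. X j \<omega>) = V \<omega>" for \<omega>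
    unfolding f_def V_def by (rule periodogram_laplace_cong) simp
  ultimately have "expectation (\<lambda>\<omega>. (V \<omega> - expectation V) ^ 4) \<le> 4 * K\<^sup>2"
    by simp
  also have "K \<le> (32 * m + 1152 * m\<^sup>2) * a ^ 4 / real n"
  proof -
    have "2 * D * m + 18 * m\<^sup>2 * D\<^sup>2 = 8 * m * a\<^sup>2 + 288 * m\<^sup>2 * a ^ 4"
      by (simp add: D_def power_mult_distrib)
    also have "\<dots> \<le> 8 * m * a ^ 4 + 288 * m\<^sup>2 * a ^ 4"
      using a m by (intro add_mono mult_left_mono power_increasing) auto
    finally have "K \<le> (8 * m + 288 * m\<^sup>2) * a ^ 4 / real (num_freqs n)"
      unfolding K_def by (intro divide_right_mono) (simp_all add: distrib_right)
    also have "\<dots> \<le> (8 * m + 288 * m\<^sup>2) * a ^ 4 / (real n / 4)"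
      using r m n a by (intro divide_left_mono) auto
    finally show ?thesis by (simp add: algebra_simps add_divide_distrib)
  qed
  then have "4 * K\<^sup>2 \<le> 4 * ((32 * m + 1152 * m\<^sup>2) * a ^ 4 / real n)\<^sup>2"
    using m D0 by (intro mult_left_mono power_mono) (auto simp: K_def)
  finally show ?thesis by simp
qed

lemma clipped_laplace_AE_concentration:
  fixes X :: "nat \<Rightarrow> 'a \<Rightarrow> real"
  assumes indep: "indep_vars (\<lambda>_. borel) X {1..}" and m: "m \<ge> 0"
  defines "V \<equiv> (\<lambda>n \<omega>. periodogram_laplace m (\<lambda>j. clip (clip_level n) (X j \<omega>)) n)"
  shows "AE \<omega> in M. (\<lambda>n. V n \<omega> - expectation (V n)) \<longlonglongrightarrow> 0"
proof -
  have X: "X j \<in> borel_measurable M" if "j \<in> {1..}" for j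
    using indep that by (auto simp: indep_vars_def)
  have V_meas [measurable]: "V n \<in> borel_measurable M" for n
    unfolding V_def using X
    by (intro periodogram_laplace_measurable measurable_compose[OF _ clip_measurable]) auto
  have V_bd: "\<bar>V n \<omega>\<bar> \<le> 1" for n \<omega>
    unfolding V_def by (rule periodogram_laplace_bounds[OF m])
  have EV_bd: "\<bar>expectation (V n)\<bar> \<le> 1" for n
    using V_bd by (intro abs_expectation_le) auto
  have int: "integrable M (\<lambda>\<omega>. (V n \<omega> - expectation (V n)) ^ 4)" for n
  proof (rule integrable_bounded[where B = "2 ^ 4"])
    fix \<omega>
    have "\<bar>V n \<omega> - expectation (V n)\<bar> \<le> 2"
      using V_bd[of n \<omega>] EV_bd[of n] by linarith
    then have "\<bar>V n \<omega> - expectation (V n)\<bar> ^ 4 \<le> 2 ^ 4"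
      by (intro power_mono) auto
    then show "\<bar>(V n \<omega> - expectation (V n)) ^ 4\<bar> \<le> 2 ^ 4"
      by (simp add: power_abs)
  qed measurable
  define c where "c = 4 * (32 * m + 1152 * m\<^sup>2)\<^sup>2"
  have bound: "expectation (\<lambda>\<omega>. (V n \<omega> - expectation (V n)) ^ 4) \<le> c * real n powr (- 3 / 2)" if n: "n \<ge> 3" for n
  proof -
    have a: "clip_level n \<ge> 1"
      using n by (simp add: clip_level_def ge_one_powr_ge_zero)
    have "((32 * m + 1152 * m\<^sup>2) * clip_level n ^ 4 / real n)\<^sup>2 =
        (32 * m + 1152 * m\<^sup>2)\<^sup>2 * (clip_level n ^ 8 / (real n)\<^sup>2)"
      by (simp add: power_mult_distrib power_divide flip: power_mult)
    also have "clip_level n ^ 8 / (real n)\<^sup>2 = real n powr (- 3 / 2)"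
    proof -
      have "clip_level n ^ 8 = real n powr (1 / 2)"
        using n by (simp add: clip_level_def powr_power)
      moreover have "(real n)\<^sup>2 = real n powr 2"
        using n by (simp add: powr_numeral)
      ultimately have "clip_level n ^ 8 / (real n)\<^sup>2 = real n powr (1 / 2) / real n powr 2"
        by (simp only:)
      also have "\<dots> = real n powr (1 / 2 - 2)"
        by (rule powr_diff[symmetric])
      finally show ?thesis by simp
    qed
    finally show ?thesis
      using clipped_laplace_fourth_moment[OF indep m a n] unfolding V_def c_def by simp
  qed
  have "AE \<omega> in M. (\<lambda>n. (V n \<omega> - expectation (V n)) ^ 4) \<longlonglongrightarrow> 0"
  proof (rule AE_tendsto_0_of_summable_integrals[OF int])
    show "summable (\<lambda>n. expectation (\<lambda>\<omega>. (V n \<omega> - expectation (V n)) ^ 4))"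
    proof (rule summable_comparison_test_ev)
      show "\<forall>\<^sub>F n in sequentially. norm (expectation (\<lambda>\<omega>. (V n \<omega> - expectation (V n)) ^ 4)) \<le> c * real n powr (- 3 / 2)"
        using eventually_ge_at_top[of "3::nat"]
        by eventually_elim (use bound in simp)
      show "summable (\<lambda>n. c * real n powr (- 3 / 2))"
        by (intro summable_mult) (simp add: summable_real_powr_iff)
    qed
  qed simp
  then show ?thesis
  proof eventually_elim
    case (elim \<omega>)
    then have "(\<lambda>n. root 4 ((V n \<omega> - expectation (V n)) ^ 4)) \<longlonglongrightarrow> root 4 0"
      by (rule tendsto_real_root)
    moreover have "root 4 (t ^ 4) = \<bar>t\<bar>" for t :: real
      using real_root_power_cancel[of 4 "\<bar>t\<bar>"] by (simp add: power_even_abs)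
    ultimately have "(\<lambda>n. \<bar>V n \<omega> - expectation (V n)\<bar>) \<longlonglongrightarrow> 0"
      by simp
    then show ?case
      by (rule tendsto_rabs_zero_cancel)
  qed
qed

text \<open>
  The clipping errors decrease as the level grows, so for \<open>n\<close> between \<open>2 ^ p\<close> and \<open>2 ^ Suc p\<close>
  the average is dominated by \<open>S p\<close>, which clips at the level of \<open>2 ^ p\<close>, divides by \<open>2 ^ p\<close>
  and sums up to \<open>2 ^ Suc p\<close>.  Its expectation decays geometrically in \<open>p\<close>.
\<close>

lemma clip_error_AE_tendsto_0:
  fixes X :: "nat \<Rightarrow> 'a \<Rightarrow> real"
  assumes X: "\<And>j. j \<ge> 1 \<Longrightarrow> X j \<in> borel_measurable M"
    and int3: "\<And>j. j \<ge> 1 \<Longrightarrow> integrable M (\<lambda>\<omega>. \<bar>X j \<omega>\<bar> ^ 3)"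
    and m3: "\<And>j. j \<ge> 1 \<Longrightarrow> expectation (\<lambda>\<omega>. \<bar>X j \<omega>\<bar> ^ 3) \<le> C"
  shows "AE \<omega> in M. (\<lambda>n. 1 / real n * (\<Sum>j=1..n. (X j \<omega> - clip (clip_level n) (X j \<omega>))\<^sup>2)) \<longlonglongrightarrow> 0"
proof -
  define Y where "Y p j \<omega> = (X j \<omega> - clip (clip_level (2 ^ p)) (X j \<omega>))\<^sup>2" for p j \<omega>
  define S where "S p \<omega> = 1 / 2 ^ p * (\<Sum>j=1..2 ^ Suc p. Y p j \<omega>)" for p \<omega>
  have lev: "clip_level (2 ^ p) = (2 powr (1 / 16)) ^ p" for p
    by (simp add: clip_level_def powr_power powr_realpow[symmetric] powr_powr)
  have lev_pos: "clip_level (2 ^ p) > 0" for p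
    by (simp add: clip_level_def)
  have Y_le: "Y p j \<omega> \<le> \<bar>X j \<omega>\<bar> ^ 3 / clip_level (2 ^ p)" for p j \<omega>
    unfolding Y_def by (rule clip_error_le[OF lev_pos])
  have Y_int: "integrable M (Y p j)" if j: "j \<ge> 1" for p j
  proof (rule Bochner_Integration.integrable_bound)
    show "integrable M (\<lambda>\<omega>. \<bar>X j \<omega>\<bar> ^ 3 / clip_level (2 ^ p))"
      using int3[OF j] by simp
    show "Y p j \<in> borel_measurable M"
      unfolding Y_def using X[OF j] by measurable
    show "AE \<omega> in M. norm (Y p j \<omega>) \<le> norm (\<bar>X j \<omega>\<bar> ^ 3 / clip_level (2 ^ p))"
      using Y_le[of p j] lev_pos[of p] by (intro AE_I2) (auto simp: Y_def)
  qed
  have EY: "expectation (Y p j) \<le> C / clip_level (2 ^ p)" if j: "j \<ge> 1" for p j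
  proof -
    have "expectation (Y p j) \<le> expectation (\<lambda>\<omega>. \<bar>X j \<omega>\<bar> ^ 3 / clip_level (2 ^ p))"
      using Y_le int3[OF j] Y_int[OF j] by (intro integral_mono) auto
    also have "\<dots> \<le> C / clip_level (2 ^ p)"
      using m3[OF j] lev_pos[of p] by (simp add: divide_right_mono)
    finally show ?thesis .
  qed
  have S_int: "integrable M (S p)" for p
    unfolding S_def using Y_int by (intro integrable_mult_right Bochner_Integration.integrable_sum) auto
  have S0: "0 \<le> S p \<omega>" for p \<omega>
    unfolding S_def Y_def by (intro mult_nonneg_nonneg sum_nonneg) auto
  have ES: "expectation (S p) \<le> 2 * C * (1 / 2 powr (1 / 16)) ^ p" for p
  proof -
    have "expectation (S p) = 1 / 2 ^ p * (\<Sum>j=1..2 ^ Suc p. expectation (Y p j))"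
      unfolding S_def using Y_int by simp
    also have "\<dots> \<le> 1 / 2 ^ p * (\<Sum>j=(1::nat)..2 ^ Suc p. C / clip_level (2 ^ p))"
      using EY by (intro mult_left_mono sum_mono) auto
    also have "\<dots> = 2 * C * (1 / 2 powr (1 / 16)) ^ p"
      by (simp add: lev power_divide)
    finally show ?thesis .
  qed
  have "AE \<omega> in M. (\<lambda>p. S p \<omega>) \<longlonglongrightarrow> 0"
  proof (rule AE_tendsto_0_of_summable_integrals[OF S_int S0])
    show "summable (\<lambda>p. expectation (S p))"
    proof (rule summable_comparison_test')
      show "summable (\<lambda>p. 2 * C * (1 / 2 powr (1 / 16)) ^ p)"
        by (intro summable_mult summable_geometric) (simp add: divide_less_eq_1)
      show "norm (expectation (S p)) \<le> 2 * C * (1 / 2 powr (1 / 16)) ^ p" for p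
        using ES[of p] S0 by (simp add: Bochner_Integration.integral_nonneg)
    qed
  qed
  then show ?thesis
  proof eventually_elim
    case (elim \<omega>)
    define T where "T n = 1 / real n * (\<Sum>j=1..n. (X j \<omega> - clip (clip_level n) (X j \<omega>))\<^sup>2)" for n
    have T_le: "T n \<le> S p \<omega>" if p: "2 ^ p \<le> n" "n < 2 ^ Suc p" for n p
    proof -
      have pn: "(2::real) ^ p \<le> real n"
        using p(1) by (metis of_nat_le_iff of_nat_numeral of_nat_power)
      then have lev_mono: "clip_level (2 ^ p) \<le> clip_level n"
        unfolding clip_level_def by (intro powr_mono2) auto
      have "(\<Sum>j=1..n. (X j \<omega> - clip (clip_level n) (X j \<omega>))\<^sup>2) \<le> (\<Sum>j=1..n. Y p j \<omega>)"
        unfolding Y_def using lev_mono lev_pos[of p]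
        by (intro sum_mono clip_error_antimono) auto
      also have "\<dots> \<le> (\<Sum>j=1..2 ^ Suc p. Y p j \<omega>)"
        using p by (intro sum_mono2) (auto simp: Y_def)
      finally have "T n \<le> 1 / real n * (\<Sum>j=1..2 ^ Suc p. Y p j \<omega>)"
        unfolding T_def by (intro mult_left_mono) auto
      also have "\<dots> \<le> S p \<omega>"
        unfolding S_def
      proof (rule mult_right_mono)
        have "(0::real) < 2 ^ p" by simp
        with pn have "0 < real n" by linarith
        with pn show "1 / real n \<le> 1 / 2 ^ p"
          by (intro divide_left_mono) auto
      qed (auto simp: Y_def intro!: sum_nonneg)
      finally show ?thesis .
    qed
    have "T \<longlonglongrightarrow> 0"
    proof (rule LIMSEQ_I)
      fix e :: real assume e: "e > 0"
      obtain p0 where p0: "\<And>p. p \<ge> p0 \<Longrightarrow> norm (S p \<omega> - 0) < e"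
        using LIMSEQ_D[OF elim e] by auto
      have "norm (T n - 0) < e" if n: "n \<ge> 2 ^ p0" for n
      proof -
        have "1 \<le> n" using n by (meson le_trans one_le_numeral one_le_power)
        then obtain p where p: "2 ^ p \<le> n" "n < 2 ^ Suc p"
          using ex_power_ivl1[of 2 n] by auto
        have "(2::nat) ^ p0 < 2 ^ Suc p" using n p(2) by linarith
        then have "p0 \<le> p" by (simp add: power_strict_increasing_iff del: power_Suc)
        moreover have "0 \<le> T n"
          unfolding T_def by (intro mult_nonneg_nonneg sum_nonneg) auto
        ultimately show ?thesis
          using p0[of p] T_le[OF p] by simp
      qed
      then show "\<exists>N. \<forall>n\<ge>N. norm (T n - 0) < e" by blast
    qed
    then show ?case by (simp add: T_def[abs_def])
  qed
qed

text \<open>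
  \<open>W\<close> belongs to the observations and \<open>V\<close> to the clipped observations.  Since \<open>W - V\<close> is
  bounded and tends to 0 almost surely, the means of \<open>V\<close> have the same limit as those of \<open>W\<close>;
  then \<open>V\<close> follows its mean, and \<open>W\<close> follows \<open>V\<close>.  The comparison of means runs through \<open>W\<close>
  because clipping disturbs the first two moments of the observations.
\<close>

lemma periodogram_laplace_AE_tendsto:
  fixes X :: "nat \<Rightarrow> 'a \<Rightarrow> real"
  assumes indep: "indep_vars (\<lambda>_. borel) X {1..}"
    and m1: "\<And>j. j \<ge> 1 \<Longrightarrow> expectation (X j) = 0"
    and m2: "\<And>j. j \<ge> 1 \<Longrightarrow> expectation (\<lambda>\<omega>. (X j \<omega>)\<^sup>2) = 1"
    and int3: "\<And>j. j \<ge> 1 \<Longrightarrow> integrable M (\<lambda>\<omega>. \<bar>X j \<omega>\<bar> ^ 3)"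
    and m3: "\<And>j. j \<ge> 1 \<Longrightarrow> expectation (\<lambda>\<omega>. \<bar>X j \<omega>\<bar> ^ 3) \<le> C"
    and m: "m \<ge> 0"
  shows "AE \<omega> in M. (\<lambda>n. periodogram_laplace m (\<lambda>j. X j \<omega>) n) \<longlonglongrightarrow> 1 / (m + 1)"
proof -
  define W where "W n \<omega> = periodogram_laplace m (\<lambda>j. X j \<omega>) n" for n \<omega>
  define V where "V n \<omega> = periodogram_laplace m (\<lambda>j. clip (clip_level n) (X j \<omega>)) n" for n \<omega>
  have X: "X j \<in> borel_measurable M" if "j \<ge> 1" for j
    using indep that by (auto simp: indep_vars_def)
  have W_meas [measurable]: "W n \<in> borel_measurable M" for n
    unfolding W_def using X by (intro periodogram_laplace_measurable) auto
  have V_meas [measurable]: "V n \<in> borel_measurable M" for n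
    unfolding V_def using X
    by (intro periodogram_laplace_measurable measurable_compose[OF _ clip_measurable]) auto
  have W_bd: "\<bar>W n \<omega>\<bar> \<le> 1" and V_bd: "\<bar>V n \<omega>\<bar> \<le> 1" for n \<omega>
    unfolding V_def W_def by (rule periodogram_laplace_bounds[OF m])+
  have "AE \<omega> in M. (\<lambda>n. 1 / real n * (\<Sum>j=1..n. (X j \<omega> - clip (clip_level n) (X j \<omega>))\<^sup>2)) \<longlonglongrightarrow> 0"
    by (rule clip_error_AE_tendsto_0[OF X int3 m3])
  then have diff: "AE \<omega> in M. (\<lambda>n. W n \<omega> - V n \<omega>) \<longlonglongrightarrow> 0"
  proof eventually_elim
    case (elim \<omega>)
    define T where "T n = 1 / real n * (\<Sum>j=1..n. (X j \<omega> - clip (clip_level n) (X j \<omega>))\<^sup>2)" for n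
    have "\<forall>\<^sub>F n in sequentially. norm ((W n \<omega> - V n \<omega>)\<^sup>2) \<le> 4 * m * T n"
      using eventually_ge_at_top[of "3::nat"]
    proof eventually_elim
      case (elim n)
      note r = num_freqs_bounds[OF elim]
      let ?S = "\<Sum>j=1..n. (X j \<omega> - clip (clip_level n) (X j \<omega>))\<^sup>2"
      have "(W n \<omega> - V n \<omega>)\<^sup>2 \<le> m / real (num_freqs n) * ?S"
        unfolding W_def V_def by (rule periodogram_laplace_lipschitz[OF m elim])
      also have "\<dots> \<le> m / (real n / 4) * ?S"
        using r m elim by (intro mult_right_mono divide_left_mono sum_nonneg) auto
      also have "m / (real n / 4) * ?S = 4 * m * T n"
        by (simp add: T_def)
      finally show ?case by simp
    qed
    moreover have "(\<lambda>n. 4 * m * T n) \<longlonglongrightarrow> 0"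
      using elim unfolding T_def by (rule tendsto_mult_right_zero)
    ultimately have "(\<lambda>n. (W n \<omega> - V n \<omega>)\<^sup>2) \<longlonglongrightarrow> 0"
      by (rule Lim_null_comparison)
    then have "(\<lambda>n. sqrt ((W n \<omega> - V n \<omega>)\<^sup>2)) \<longlonglongrightarrow> sqrt 0"
      by (rule tendsto_real_sqrt)
    then have "(\<lambda>n. \<bar>W n \<omega> - V n \<omega>\<bar>) \<longlonglongrightarrow> 0"
      by (simp only: real_sqrt_abs real_sqrt_zero)
    then show "(\<lambda>n. W n \<omega> - V n \<omega>) \<longlonglongrightarrow> 0"
      by (rule tendsto_rabs_zero_cancel)
  qed
  have "(\<lambda>n. expectation (\<lambda>\<omega>. W n \<omega> - V n \<omega>)) \<longlonglongrightarrow> expectation (\<lambda>\<omega>. 0)"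
  proof (rule integral_dominated_convergence[where w = "\<lambda>_. 2"])
    show "AE \<omega> in M. norm (W n \<omega> - V n \<omega>) \<le> 2" for n
    proof (rule AE_I2)
      fix \<omega>
      show "norm (W n \<omega> - V n \<omega>) \<le> 2"
        using W_bd[of n \<omega>] V_bd[of n \<omega>] unfolding real_norm_def by linarith
    qed
  qed (use diff in auto)
  moreover have "expectation (\<lambda>\<omega>. W n \<omega> - V n \<omega>) = expectation (W n) - expectation (V n)" for n
    by (rule Bochner_Integration.integral_diff[OF integrable_bounded[OF W_meas W_bd] integrable_bounded[OF V_meas V_bd]])
  ultimately have "(\<lambda>n. expectation (W n) - expectation (V n)) \<longlonglongrightarrow> 0"
    by simp
  moreover have "(\<lambda>n. expectation (W n)) \<longlonglongrightarrow> 1 / (m + 1)"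
    unfolding W_def by (rule expectation_periodogram_laplace_tendsto[OF indep m1 m2 int3 m3 m])
  ultimately have "(\<lambda>n. expectation (W n) - (expectation (W n) - expectation (V n))) \<longlonglongrightarrow> 1 / (m + 1) - 0"
    by (intro tendsto_diff)
  then have EV: "(\<lambda>n. expectation (V n)) \<longlonglongrightarrow> 1 / (m + 1)"
    by simp
  have "AE \<omega> in M. (\<lambda>n. V n \<omega> - expectation (V n)) \<longlonglongrightarrow> 0"
    unfolding V_def by (rule clipped_laplace_AE_concentration[OF indep m])
  with diff have "AE \<omega> in M. (\<lambda>n. W n \<omega>) \<longlonglongrightarrow> 1 / (m + 1)"
  proof eventually_elim
    case (elim \<omega>)
    from tendsto_add[OF tendsto_add[OF elim] EV] show ?case by simp
  qed
  then show ?thesis by (simp add: W_def)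
qed

end

lemma periodogram_nonneg: "0 \<le> periodogram x n \<theta>"
  by (simp add: periodogram_def)

text \<open>
  This step concerns a single data sequence: \<open>t \<mapsto> exp (- t)\<close> maps \<open>[0, \<infinity>)\<close> into
  \<open>[0, 1]\<close> and carries the empirical distribution function to the fraction of sample points in an upper tail.
\<close>

lemma edf_deviation_tendsto_0:
  assumes lap: "\<And>m::nat. (\<lambda>n. periodogram_laplace (real m) x n) \<longlonglongrightarrow> 1 / (real m + 1)"
  shows "(\<lambda>n. SUP t\<in>{0..}. \<bar>periodogram_edf x n t - (1 - exp (- t))\<bar>) \<longlonglongrightarrow> 0"
proof -
  define U where "U n k = exp (- periodogram x n (2 * pi * real k / real n))" for n k
  have U: "U n k \<in> {0..1}" for n k
    using periodogram_nonneg by (simp add: U_def)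
  have "1 / real (num_freqs n) * (\<Sum>k=1..num_freqs n. U n k ^ m) = periodogram_laplace (real m) x n" for m n
    by (simp add: periodogram_laplace_def gaussian_bump_scaled_dft U_def exp_of_nat_mult[symmetric])
  then have lim: "uniform_limit {0..1} (\<lambda>n. upper_fraction (U n) (num_freqs n)) (\<lambda>u. 1 - u) sequentially"
    using lap U by (intro upper_fraction_uniform_limit) auto
  have edf: "periodogram_edf x n t = upper_fraction (U n) (num_freqs n) (exp (- t))" for n t
    by (simp add: periodogram_edf_def upper_fraction_def U_def)
  show ?thesis
  proof (rule LIMSEQ_I)
    fix e :: real assume e: "e > 0"
    then have "\<forall>\<^sub>F n in sequentially. \<forall>u\<in>{0..1}. dist (upper_fraction (U n) (num_freqs n) u) (1 - u) < e / 2"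
      by (intro uniform_limitD[OF lim]) simp
    then have "\<forall>\<^sub>F n in sequentially. norm ((SUP t\<in>{0..}. \<bar>periodogram_edf x n t - (1 - exp (- t))\<bar>) - 0) < e"
    proof eventually_elim
      case (elim n)
      have "\<bar>SUP t\<in>{0..}. \<bar>periodogram_edf x n t - (1 - exp (- t))\<bar>\<bar> \<le> e / 2"
      proof (rule cSup_abs_le)
        fix s assume "s \<in> (\<lambda>t. \<bar>periodogram_edf x n t - (1 - exp (- t))\<bar>) ` {0..}"
        then obtain t where t: "t \<ge> 0" "s = \<bar>periodogram_edf x n t - (1 - exp (- t))\<bar>"
          by auto
        have "exp (- t) \<in> {0..1}" using t(1) by simp
        with elim have "dist (upper_fraction (U n) (num_freqs n) (exp (- t))) (1 - exp (- t)) < e / 2"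
          by blast
        then show "\<bar>s\<bar> \<le> e / 2"
          unfolding t(2) edf dist_real_def by linarith
      qed simp
      then show ?case using e by simp
    qed
    then show "\<exists>N. \<forall>n\<ge>N. norm ((SUP t\<in>{0..}. \<bar>periodogram_edf x n t - (1 - exp (- t))\<bar>) - 0) < e"
      by (simp add: eventually_sequentially)
  qed
qed

theorem corollary1p4:
  fixes P :: "'a measure" and X :: "nat \<Rightarrow> 'a \<Rightarrow> real" and M :: real
  assumes "prob_space P"
    and "prob_space.indep_vars P (\<lambda>_. borel) X {1..}"
    and "\<And>j. j \<ge> 1 \<Longrightarrow> prob_space.expectation P (X j) = 0"
    and "\<And>j. j \<ge> 1 \<Longrightarrow> prob_space.expectation P (\<lambda>\<omega>. (X j \<omega>)\<^sup>2) = 1"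
    and "\<And>j. j \<ge> 1 \<Longrightarrow> integrable P (\<lambda>\<omega>. \<bar>X j \<omega>\<bar> ^ 3)"
    and "\<And>j. j \<ge> 1 \<Longrightarrow> prob_space.expectation P (\<lambda>\<omega>. \<bar>X j \<omega>\<bar> ^ 3) \<le> M"
  shows "AE \<omega> in P.
           (\<lambda>n. SUP x\<in>{0..}. \<bar>periodogram_edf (\<lambda>j. X j \<omega>) n x - (1 - exp (- x))\<bar>) \<longlonglongrightarrow> 0"
proof -
  interpret prob_space P by fact
  have "AE \<omega> in P. \<forall>m::nat. (\<lambda>n. periodogram_laplace (real m) (\<lambda>j. X j \<omega>) n) \<longlonglongrightarrow> 1 / (real m + 1)"
    unfolding AE_all_countable using assms(2-) by (intro allI periodogram_laplace_AE_tendsto) auto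
  then show ?thesis
    by eventually_elim (rule edf_deviation_tendsto_0, blast)
qed

end
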